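(* Let $d\ge1$, $T>0$, let $f:[0,T]\times\Sigma(\mathbb{R}^d)\to\hat\Sigma(\mathbb{R}^d)$ be continuous (with respect to the maximum norm), let $A_0\in\mathcal{K}_c(\mathbb{R}^d)$, let $r>0$, and put $$D_r:=\{\sigma\in\Sigma(\mathbb{R}^d):\|\sigma-\sigma_{A_0}\|_\infty\le r\},\qquad D_r':=\{A\in\mathcal{K}_c(\mathbb{R}^d):\operatorname{dist}_H(A,A_0)\le r\}.$$ Let $c>0$ be such that $\|f(t,\sigma)\|_\infty\le c$ for all $t\in[0,T]$ and $\sigma\in D_r$, and let $\beta:=\min\{T,r/c\}$. Let $\omega:(0,T]\times\mathbb{R}_0^+\to\mathbb{R}$ be of class $U_1$, and assume that $$f(t,\sigma)\in\overline{\Sigma(\mathbb{R}^d)-\mathbb{R}_0^+\sigma}\quad\text{for all } t\in[0,T],\ \sigma\in\Sigma(\mathbb{R}^d).$$ Suppose in addition that for any $t\in(0,\beta]$ and any $A,B\in D_r'$ with $A\ne B$ there exist $a\in A$ and $b\in B$ such that $p:=(a-b)/\|a-b\|$ is well-defined (i.e. $a\neq b$) and at least one of the following two conditions is satisfied: (i) $\|a-b\|=\operatorname{dist}(a,B)=\operatorname{dist}(A,B)=\operatorname{dist}_H(A,B)$ and $f(t,\sigma_A)(p)-f(t,\sigma_B)(p)\le\omega(t,\operatorname{dist}_H(A,B))$; (ii) $\|a-b\|=\operatorname{dist}(b,A)=\operatorname{dist}(B,A)=\operatorname{dist}_H(A,B)$ and $f(t,\sigma_B)(-p)-f(t,\sigma_A)(-p)\le\omega(t,\operatorname{dist}_H(A,B))$.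 Then there exists a unique solution $\sigma:[0,\beta]\to D_r$ of the initial value problem $$\tfrac{d}{dt}\sigma(t)=f(t,\sigma(t)),\quad\sigma(0)=\sigma_{A_0}.$$
   Context: $\mathcal{K}_c(\mathbb{R}^d)$ is the family of nonempty convex compact subsets of $\mathbb{R}^d$; $\|\cdot\|$ is the Euclidean norm. For $A,B\in\mathcal{K}_c(\mathbb{R}^d)$, $\operatorname{dist}(A,B):=\sup_{a\in A}\inf_{b\in B}\|a-b\|$, $\operatorname{dist}_H(A,B):=\max\{\operatorname{dist}(A,B),\operatorname{dist}(B,A)\}$, and for a point $a$, $\operatorname{dist}(a,B):=\operatorname{dist}(\{a\},B)$. $\mathbb{S}^{d-1}\subset\mathbb{R}^d$ is the Euclidean unit sphere and $C(\mathbb{S}^{d-1})$ is the Banach space of continuous real-valued functions on it with the maximum norm $\|\cdot\|_\infty$. The support function of $A$ is $\sigma_A:\mathbb{S}^{d-1}\to\mathbb{R}$, $\sigma_A(p)=\sup_{a\in A}\langle p,a\rangle$. Set $\Sigma(\mathbb{R}^d):=\{\sigma_A:A\in\mathcal{K}_c(\mathbb{R}^d)\}$ and $\hat\Sigma(\mathbb{R}^d):=\{\sigma_A-\sigma_B:A,B\in\mathcal{K}_c(\mathbb{R}^d)\}$, both regarded as subsets of $C(\mathbb{S}^{d-1})$. $\mathbb{R}_0^+=[0,\infty)$, and $\Sigma(\mathbb{R}^d)-\mathbb{R}_0^+\sigma=\{\tau-\lambda\sigma:\tau\in\Sigma(\mathbb{R}^d),\ \lambda\ge0\}$; the closure is taken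 in $C(\mathbb{S}^{d-1})$. Class $U_1$: a function $\omega:(0,T]\times\mathbb{R}_0^+\to\mathbb{R}$ is of class $U_1$ if for each $\epsilon>0$ there are $\delta>0$, a sequence $(t_i)$ in $(0,T)$ with $t_i\to0^+$, and continuous functions $\rho_i:[t_i,T]\to\mathbb{R}_0^+$ such that: (a) $\rho_i(t_i)\ge\delta t_i$ for all $i$; (b) $0<\rho_i(t)\le\epsilon$ for all $i$ and $t\in(t_i,T]$; (c) there is a sequence $(\delta_i)$ with $\delta_i>0$ such that $D^-\rho_i(t)\ge\omega(t,\rho_i(t))+\delta_i$ for all $i$ and $t\in(t_i,T]$. Here $D^-\rho(t)=\liminf_{h\searrow0}h^{-1}(\rho(t)-\rho(t-h))$. A solution on $[0,\beta]$ is a continuous curve $\sigma:[0,\beta]\to C(\mathbb{S}^{d-1})$ with values in $\Sigma(\mathbb{R}^d)$ that satisfies the initial condition and is Fréchet differentiable (with respect to $\|\cdot\|_\infty$) with the differential equation holding at every $t\in(0,\beta)$. *)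

theory Defs
  imports "HOL-Analysis.Analysis"
begin

text \<open>
  The unit sphere is made a type, so that \<^typ>\<open>'a::topological_space \<Rightarrow>\<^sub>C real\<close> over it is the
  Banach space of continuous functions with the maximum norm (boundedness is automatic, as the
  sphere is compact). Every type of class \<^class>\<open>euclidean_space\<close> has dimension at least 1,
  so the sphere is nonempty.
\<close>

typedef (overloaded) 'a usphere = "sphere (0 :: 'a::euclidean_space) 1"
  morphisms dir_vec Abs_usphere
  by (rule exI[of _ "SOME b. b \<in> Basis"]) (simp add: some_in_eq)

instantiation usphere :: (euclidean_space) metric_space
begin

definition dist_usphere :: "'a usphere \<Rightarrow> 'a usphere \<Rightarrow> real"
  where "dist_usphere p q = dist (dir_vec p) (dir_vec q)"

definition uniformity_usphere :: "('a usphere \<times> 'a usphere) filter"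
  where "uniformity_usphere = (INF e\<in>{0 <..}. principal {(x, y). dist x y < e})"

definition open_usphere :: "'a usphere set \<Rightarrow> bool"
  where "open_usphere S = (\<forall>x\<in>S. \<forall>\<^sub>F (x', y) in uniformity. x' = x \<longrightarrow> y \<in> S)"

instance
  by standard
    (auto simp: dist_usphere_def dir_vec_inject dist_triangle2 open_usphere_def
      uniformity_usphere_def)

end

lemma norm_dir_vec [simp]: "norm (dir_vec p) = 1"
  using dir_vec[of p] by simp

lemma continuous_on_dir_vec: "continuous_on S dir_vec"
  unfolding continuous_on_iff by (auto simp: dist_usphere_def)

lemma compact_UNIV_usphere: "compact (UNIV :: 'a::euclidean_space usphere set)"
proof -
  have "continuous_on (sphere 0 1) (Abs_usphere :: 'a \<Rightarrow> 'a usphere)"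
    unfolding continuous_on_iff by (auto simp: dist_usphere_def Abs_usphere_inverse)
  then have "compact ((Abs_usphere :: 'a \<Rightarrow> 'a usphere) ` sphere 0 1)"
    by (rule compact_continuous_image) simp
  moreover have "(Abs_usphere :: 'a \<Rightarrow> 'a usphere) ` sphere 0 1 = UNIV"
    using type_definition.Abs_image[OF type_definition_usphere] .
  ultimately show ?thesis by simp
qed

lemma continuous_imp_bcontfun_usphere:
  fixes g :: "'a::euclidean_space usphere \<Rightarrow> real"
  assumes "continuous_on UNIV g"
  shows "g \<in> bcontfun"
  using assms compact_imp_bounded[OF compact_continuous_image[OF assms compact_UNIV_usphere]]
  by (simp add: bcontfun_def)

definition convex_bodies :: "'a::euclidean_space set set"
  where "convex_bodies = {A. A \<noteq> {} \<and> convex A \<and> compact A}"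

definition support_fun :: "'a::euclidean_space set \<Rightarrow> 'a usphere \<Rightarrow>\<^sub>C real"
  where "support_fun A = Bcontfun (\<lambda>p. SUP a\<in>A. dir_vec p \<bullet> a)"

lemma support_fun_apply:
  fixes A :: "'a::euclidean_space set"
  assumes "A \<in> convex_bodies"
  shows "apply_bcontfun (support_fun A) p = (SUP a\<in>A. dir_vec p \<bullet> a)"
proof -
  let ?s = "\<lambda>p. SUP a\<in>A. dir_vec p \<bullet> a"
  have ne: "A \<noteq> {}" and "bounded A"
    using assms compact_imp_bounded by (auto simp: convex_bodies_def)
  then obtain M where "M > 0" and M: "\<And>a. a \<in> A \<Longrightarrow> norm a \<le> M"
    by (auto simp: bounded_pos)
  have bdd: "bdd_above ((\<lambda>a. dir_vec q \<bullet> a) ` A)" for q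
  proof (rule bdd_aboveI2)
    fix a assume "a \<in> A"
    then show "dir_vec q \<bullet> a \<le> M"
      using norm_cauchy_schwarz[of "dir_vec q" a] M[of a] by simp
  qed
  have le: "?s q \<le> ?s q' + M * dist q q'" for q q'
  proof (rule cSUP_least[OF ne])
    fix a assume a: "a \<in> A"
    have "dir_vec q \<bullet> a = dir_vec q' \<bullet> a + (dir_vec q - dir_vec q') \<bullet> a"
      by (simp add: inner_diff_left)
    also have "(dir_vec q - dir_vec q') \<bullet> a \<le> norm (dir_vec q - dir_vec q') * norm a"
      by (rule norm_cauchy_schwarz)
    also have "\<dots> \<le> norm (dir_vec q - dir_vec q') * M"
      by (rule mult_left_mono[OF M[OF a]]) simp
    also have "dir_vec q' \<bullet> a \<le> ?s q'"
      by (rule cSUP_upper[OF a bdd])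
    finally show "dir_vec q \<bullet> a \<le> ?s q' + M * dist q q'"
      by (simp add: dist_usphere_def dist_norm mult.commute)
  qed
  have "M-lipschitz_on UNIV ?s"
  proof (rule lipschitz_onI)
    fix q q' :: "'a usphere"
    show "dist (?s q) (?s q') \<le> M * dist q q'"
      using le[of q q'] le[of q' q] by (simp add: dist_real_def dist_commute abs_le_iff)
  qed (use \<open>M > 0\<close> in simp)
  then have "continuous_on UNIV ?s"
    by (rule lipschitz_on_continuous_on)
  then show ?thesis
    unfolding support_fun_def
    by (simp add: Bcontfun_inverse continuous_imp_bcontfun_usphere)
qed

definition support_funs :: "('a::euclidean_space usphere \<Rightarrow>\<^sub>C real) set"
  where "support_funs = support_fun ` convex_bodies"

definition support_fun_diffs :: "('a::euclidean_space usphere \<Rightarrow>\<^sub>C real) set"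
  where "support_fun_diffs =
    {support_fun A - support_fun B | A B. A \<in> convex_bodies \<and> B \<in> convex_bodies}"

definition excess :: "'a::euclidean_space set \<Rightarrow> 'a set \<Rightarrow> real"
  where "excess A B = (SUP a\<in>A. INF b\<in>B. norm (a - b))"

definition hausdorff_dist :: "'a::euclidean_space set \<Rightarrow> 'a set \<Rightarrow> real"
  where "hausdorff_dist A B = max (excess A B) (excess B A)"

text \<open>The lower left Dini derivative, which may be infinite.\<close>

definition dini_lower_left :: "(real \<Rightarrow> real) \<Rightarrow> real \<Rightarrow> ereal"
  where "dini_lower_left \<rho> t = Liminf (at_right 0) (\<lambda>h. ereal ((\<rho> t - \<rho> (t - h)) / h))"

text \<open>Only the values of \<open>\<omega>\<close> on \<open>{0<..T} \<times> {0..}\<close> matter.\<close>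

definition class_U1 :: "real \<Rightarrow> (real \<Rightarrow> real \<Rightarrow> real) \<Rightarrow> bool"
  where "class_U1 T \<omega> \<longleftrightarrow>
    (\<forall>\<epsilon>>0. \<exists>\<delta>>0. \<exists>(s :: nat \<Rightarrow> real) (\<rho> :: nat \<Rightarrow> real \<Rightarrow> real).
      (\<forall>i. s i \<in> {0<..<T}) \<and> s \<longlonglongrightarrow> 0 \<and>
      (\<forall>i. continuous_on {s i..T} (\<rho> i) \<and> (\<forall>t\<in>{s i..T}. 0 \<le> \<rho> i t)) \<and>
      (\<forall>i. \<rho> i (s i) \<ge> \<delta> * s i) \<and>
      (\<forall>i. \<forall>t\<in>{s i<..T}. 0 < \<rho> i t \<and> \<rho> i t \<le> \<epsilon>) \<and>
      (\<exists>\<eta> :: nat \<Rightarrow> real. (\<forall>i. \<eta> i > 0) \<and>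
        (\<forall>i. \<forall>t\<in>{s i<..T}. dini_lower_left (\<rho> i) t \<ge> ereal (\<omega> t (\<rho> i t) + \<eta> i))))"

definition is_solution ::
  "(real \<Rightarrow> ('a::euclidean_space usphere \<Rightarrow>\<^sub>C real) \<Rightarrow> ('a usphere \<Rightarrow>\<^sub>C real)) \<Rightarrow> real \<Rightarrow>
    ('a usphere \<Rightarrow>\<^sub>C real) \<Rightarrow> (real \<Rightarrow> ('a usphere \<Rightarrow>\<^sub>C real)) \<Rightarrow> bool"
  where "is_solution f \<beta> \<sigma>0 \<sigma> \<longleftrightarrow>
    continuous_on {0..\<beta>} \<sigma> \<and> \<sigma> ` {0..\<beta>} \<subseteq> support_funs \<and> \<sigma> 0 = \<sigma>0 \<and>
    (\<forall>t\<in>{0<..<\<beta>}. (\<sigma> has_vector_derivative f t (\<sigma> t)) (at t))"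

end

theory Submission
  imports Defs "HOL-Complex_Analysis.Great_Picard"
begin

text \<open>
  Existence is Peano's theorem under a viability constraint. The support functions form a closed
  convex cone \<open>\<Sigma>\<close> whose bounded closed parts are compact (\<open>compact_support_funs_cball\<close>), and
  membership of \<open>f t \<sigma>\<close> in the closure of \<open>\<Sigma> - [0, \<infinity>) \<sigma>\<close> says exactly that \<open>f t \<sigma>\<close> is tangent
  to \<open>\<Sigma>\<close> at \<open>\<sigma>\<close>, since a cone satisfies \<open>\<Sigma> - [0, \<infinity>) \<sigma> = [0, \<infinity>) (\<Sigma> - \<sigma>)\<close>. Convexity and
  compactness make the tangency uniform: there is a step size for which an Euler step whose velocity
  is close to \<open>f\<close> and not longer than \<open>c\<close> remains in \<open>\<Sigma>\<close> from every point of the domain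
  (\<open>uniform_tangent_step\<close>). The bound \<open>c\<close> on the velocities keeps the Euler chains in the ball of
  radius \<open>r\<close> up to time \<open>\<beta>\<close>, and any pointwise cluster function of finer and finer Euler chains is a
  solution (\<open>convex_viability\<close>).

  For uniqueness, let \<open>m t\<close> be the norm of the difference of two solutions \<open>\<sigma>\<close> and \<open>\<tau>\<close> at time
  \<open>t\<close>; it is the Hausdorff distance of the underlying bodies \<open>A\<close> and \<open>B\<close>
  (\<open>hausdorff_dist_eq_norm\<close>). If \<open>b\<close> is a point of \<open>B\<close> nearest to \<open>a \<in> A\<close> and \<open>\<parallel>a - b\<parallel>\<close> equals
  that distance, then \<open>\<sigma> t - \<tau> t\<close> attains its norm in the direction \<open>p\<close> of \<open>a - b\<close>
  (\<open>support_fun_diff_nearest_point\<close>). At earlier times the value at \<open>p\<close> is still a lower bound for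
  the norm, so the lower left Dini derivative of \<open>m\<close> is at most the derivative of the difference at
  \<open>p\<close>, hence at most \<open>\<omega> t (m t)\<close>. Both solutions start with the same velocity, so \<open>m t = o(t)\<close> as \<open>t \<rightarrow> 0\<close>
  and \<open>m\<close> starts below the comparison functions \<open>\<rho>\<^sub>i\<close> of the class \<open>U\<^sub>1\<close>. It cannot cross them,
  because at a first crossing the Dini derivative of \<open>\<rho>\<^sub>i\<close> would be at most that of \<open>m\<close>, whereas it is
  strictly larger than \<open>\<omega>\<close> (\<open>class_U1_comparison\<close>). As the \<open>\<rho>\<^sub>i\<close> are arbitrarily small, \<open>m\<close>
  vanishes.
\<close>

section \<open>Support functions\<close>

lemma bdd_above_support:
  assumes "A \<in> convex_bodies"
  shows "bdd_above ((\<lambda>a. u \<bullet> a) ` A)"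
proof -
  have "compact ((\<lambda>a. u \<bullet> a) ` A)"
    using assms by (intro compact_continuous_image continuous_intros) (auto simp: convex_bodies_def)
  then show ?thesis
    by (simp add: bounded_imp_bdd_above compact_imp_bounded)
qed

lemma inner_le_support_fun:
  "A \<in> convex_bodies \<Longrightarrow> a \<in> A \<Longrightarrow> dir_vec p \<bullet> a \<le> support_fun A p"
  by (simp add: support_fun_apply cSUP_upper bdd_above_support)

lemma support_fun_le:
  "A \<in> convex_bodies \<Longrightarrow> (\<And>a. a \<in> A \<Longrightarrow> dir_vec p \<bullet> a \<le> s) \<Longrightarrow> support_fun A p \<le> s"
  by (auto simp: support_fun_apply convex_bodies_def intro!: cSUP_least)

lemma support_fun_attained:
  assumes "A \<in> convex_bodies"
  obtains a where "a \<in> A" "support_fun A p = dir_vec p \<bullet> a"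
proof -
  have "compact A" "A \<noteq> {}"
    using assms by (auto simp: convex_bodies_def)
  then obtain a where "a \<in> A" "\<And>y. y \<in> A \<Longrightarrow> dir_vec p \<bullet> y \<le> dir_vec p \<bullet> a"
    using continuous_attains_sup[of A "\<lambda>a. dir_vec p \<bullet> a"] continuous_on_inner[OF continuous_on_const continuous_on_id]
    by blast
  then show thesis
    using that assms by (metis inner_le_support_fun support_fun_le antisym)
qed

lemma support_fun_plus:
  assumes A: "A \<in> convex_bodies" and B: "B \<in> convex_bodies"
  shows "support_fun A + support_fun B \<in> support_funs"
proof -
  let ?C = "\<Union>a\<in>A. \<Union>b\<in>B. {a + b}"
  have C_eq: "?C = {a + b |a b. a \<in> A \<and> b \<in> B}"
    by auto
  have C: "?C \<in> convex_bodies"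
    using A B convex_sums[of A B] compact_sums[of A B]
    unfolding convex_bodies_def by (auto simp: C_eq)
  have "support_fun ?C = support_fun A + support_fun B"
  proof (rule bcontfun_eqI)
    fix p
    obtain a where a: "a \<in> A" "support_fun A p = dir_vec p \<bullet> a"
      using support_fun_attained[OF A] .
    obtain b where b: "b \<in> B" "support_fun B p = dir_vec p \<bullet> b"
      using support_fun_attained[OF B] .
    have "support_fun A p + support_fun B p \<le> support_fun ?C p"
      using inner_le_support_fun[OF C, of "a + b" p] a b by (auto simp: inner_add_right)
    moreover have "support_fun ?C p \<le> support_fun A p + support_fun B p"
      by (rule support_fun_le[OF C])
        (auto simp: inner_add_right intro!: add_mono inner_le_support_fun A B)
    ultimately show "support_fun ?C p = (support_fun A + support_fun B) p"
      by simp
  qed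
  then show ?thesis
    using C unfolding support_funs_def by (metis imageI)
qed

lemma support_fun_scaleR:
  assumes A: "A \<in> convex_bodies" and "0 \<le> \<mu>"
  shows "\<mu> *\<^sub>R support_fun A \<in> support_funs"
proof -
  let ?C = "(\<lambda>a. \<mu> *\<^sub>R a) ` A"
  have C: "?C \<in> convex_bodies"
    using A unfolding convex_bodies_def by (auto intro: convex_scaling compact_scaling)
  have "support_fun ?C = \<mu> *\<^sub>R support_fun A"
  proof (rule bcontfun_eqI)
    fix p
    obtain a where a: "a \<in> A" "support_fun A p = dir_vec p \<bullet> a"
      using support_fun_attained[OF A] .
    have "\<mu> * support_fun A p \<le> support_fun ?C p"
      using inner_le_support_fun[OF C, of "\<mu> *\<^sub>R a" p] a by auto
    moreover have "support_fun ?C p \<le> \<mu> * support_fun A p"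
      by (rule support_fun_le[OF C])
        (auto intro!: mult_left_mono inner_le_support_fun A \<open>0 \<le> \<mu>\<close>)
    ultimately show "support_fun ?C p = (\<mu> *\<^sub>R support_fun A) p"
      by simp
  qed
  then show ?thesis
    using C unfolding support_funs_def by (metis imageI)
qed

lemma support_funs_add: "\<sigma> \<in> support_funs \<Longrightarrow> \<tau> \<in> support_funs \<Longrightarrow> \<sigma> + \<tau> \<in> support_funs"
  by (metis support_fun_plus support_funs_def imageE)

lemma support_funs_scaleR: "\<sigma> \<in> support_funs \<Longrightarrow> 0 \<le> \<mu> \<Longrightarrow> \<mu> *\<^sub>R \<sigma> \<in> support_funs"
  by (metis support_fun_scaleR support_funs_def imageE)

lemma convex_support_funs: "convex support_funs"
  unfolding convex_def by (auto intro: support_funs_add support_funs_scaleR)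

lemma dir_vec_Abs_normalize: "x \<noteq> 0 \<Longrightarrow> dir_vec (Abs_usphere (x /\<^sub>R norm x)) = x /\<^sub>R norm x"
  by (intro Abs_usphere_inverse) simp

lemma inner_normalize_self: "(x /\<^sub>R norm x) \<bullet> x = norm x"
  by (cases "x = 0") (simp_all add: dot_square_norm power2_eq_square)

text \<open>Testing the support function in the direction of the point itself recovers its norm, so a
  bound on support functions confines the bodies to a common ball.\<close>

lemma norm_le_norm_support_fun:
  assumes "A \<in> convex_bodies" and "a \<in> A"
  shows "norm a \<le> norm (support_fun A)"
proof (cases "a = 0")
  case False
  let ?p = "Abs_usphere (a /\<^sub>R norm a)"
  have "norm a = dir_vec ?p \<bullet> a"
    unfolding dir_vec_Abs_normalize[OF False] by (rule inner_normalize_self[symmetric])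
  also have "\<dots> \<le> support_fun A ?p"
    by (rule inner_le_support_fun[OF assms])
  also have "\<dots> \<le> norm (support_fun A)"
    using norm_bounded[of "support_fun A" ?p] by simp
  finally show ?thesis .
qed simp

text \<open>A uniform limit \<open>g\<close> of support functions is the support function of the intersection of the
  half-spaces that it describes. What has to be shown is that \<open>g p\<close> is attained on that intersection:
  the bodies stay in a common ball, so the points where they attain their support values at \<open>p\<close>
  accumulate at some \<open>l\<close>, and \<open>l\<close> satisfies all the limiting half-space inequalities.\<close>

lemma closed_support_funs: "closed (support_funs :: ('a::euclidean_space usphere \<Rightarrow>\<^sub>C real) set)"
  unfolding closed_sequential_limits
proof (intro allI impI)
  fix s :: "nat \<Rightarrow> 'a usphere \<Rightarrow>\<^sub>C real" and g
  assume asm: "(\<forall>n. s n \<in> support_funs) \<and> s \<longlonglongrightarrow> g"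
  then have lim: "s \<longlonglongrightarrow> g" and "\<forall>n. \<exists>A. A \<in> convex_bodies \<and> s n = support_fun A"
    by (auto simp: support_funs_def)
  then obtain A where A: "\<And>n. A n \<in> convex_bodies" and s: "\<And>n. s n = support_fun (A n)"
    by metis
  obtain M where M: "\<And>n. norm (s n) \<le> M"
    using convergent_imp_bounded[OF lim] by (auto simp: bounded_iff)
  have limp: "(\<lambda>n. s n p) \<longlonglongrightarrow> g p" for p
  proof (rule Lim_null_comparison[THEN LIM_zero_cancel])
    show "\<forall>\<^sub>F n in sequentially. norm (s n p - g p) \<le> dist (s n) g"
      by (intro always_eventually allI) (metis dist_bounded dist_norm)
    show "(\<lambda>n. dist (s n) g) \<longlonglongrightarrow> 0"
      using lim tendsto_dist_iff by blast
  qed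
  let ?B = "{x. \<forall>p. dir_vec p \<bullet> x \<le> g p}"
  have attained: "\<exists>a\<in>?B. dir_vec p \<bullet> a = g p" for p
  proof -
    have "\<exists>a. a \<in> A n \<and> s n p = dir_vec p \<bullet> a" for n
      using support_fun_attained[OF A[of n], of p] s[of n] by auto
    then obtain a where a: "\<And>n. a n \<in> A n" "\<And>n. s n p = dir_vec p \<bullet> a n"
      by metis
    have "a n \<in> cball 0 M" for n
      using order_trans[OF norm_le_norm_support_fun[OF A a(1)]] M[of n] s[of n] by simp
    then obtain l k where "strict_mono k" and l: "(a \<circ> k) \<longlonglongrightarrow> l"
      using compact_cball[of "0::'a" M] unfolding compact_def by meson
    have lim_k: "(\<lambda>n. s (k n) q) \<longlonglongrightarrow> g q" for q
      using LIMSEQ_subseq_LIMSEQ[OF limp \<open>strict_mono k\<close>] by (simp add: o_def)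
    have lim_l: "(\<lambda>n. dir_vec q \<bullet> a (k n)) \<longlonglongrightarrow> dir_vec q \<bullet> l" for q
      using l by (intro tendsto_intros) (simp add: o_def)
    have "dir_vec q \<bullet> l \<le> g q" for q
      by (rule LIMSEQ_le[OF lim_l lim_k]) (use a(1) A s inner_le_support_fun in metis)
    moreover have "dir_vec p \<bullet> l = g p"
      using LIMSEQ_unique[OF lim_l[of p]] lim_k[of p] a(2) by simp
    ultimately show ?thesis
      by auto
  qed
  have B_eq: "?B = (\<Inter>p. {x. dir_vec p \<bullet> x \<le> g p})"
    by auto
  have "bounded ?B"
  proof (rule boundedI)
    fix x assume x: "x \<in> ?B"
    show "norm x \<le> norm g"
    proof (cases "x = 0")
      case False
      let ?p = "Abs_usphere (x /\<^sub>R norm x)"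
      have "norm x = dir_vec ?p \<bullet> x"
        unfolding dir_vec_Abs_normalize[OF False] by (rule inner_normalize_self[symmetric])
      also have "\<dots> \<le> g ?p"
        using x by blast
      also have "\<dots> \<le> norm g"
        using norm_bounded[of g ?p] by simp
      finally show ?thesis .
    qed simp
  qed
  moreover have "closed ?B" "convex ?B"
    unfolding B_eq by (auto intro!: closed_INT convex_INT closed_halfspace_le convex_halfspace_le)
  ultimately have B: "?B \<in> convex_bodies"
    using attained by (auto simp: convex_bodies_def compact_eq_bounded_closed)
  have "support_fun ?B = g"
  proof (rule bcontfun_eqI)
    fix p
    show "support_fun ?B p = g p"
      using attained[of p] inner_le_support_fun[OF B, of _ p] support_fun_le[OF B, of p "g p"]
      by fastforce
  qed
  then show "g \<in> support_funs"
    unfolding support_funs_def by (rule image_eqI[OF sym B])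
qed

lemma support_fun_lipschitz:
  assumes "A \<in> convex_bodies"
  shows "\<bar>support_fun A p - support_fun A q\<bar> \<le> norm (support_fun A) * norm (dir_vec p - dir_vec q)"
proof -
  have "support_fun A p - support_fun A q \<le> norm (support_fun A) * norm (dir_vec p - dir_vec q)"
    for p q :: "'a usphere"
  proof -
    obtain a where a: "a \<in> A" "support_fun A p = dir_vec p \<bullet> a"
      using support_fun_attained[OF assms] .
    have "support_fun A p - support_fun A q \<le> (dir_vec p - dir_vec q) \<bullet> a"
      using inner_le_support_fun[OF assms a(1), of q] a(2) by (simp add: inner_diff_left)
    also have "\<dots> \<le> norm (dir_vec p - dir_vec q) * norm a"
      by (rule norm_cauchy_schwarz)
    also have "\<dots> \<le> norm (dir_vec p - dir_vec q) * norm (support_fun A)"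
      by (intro mult_left_mono norm_le_norm_support_fun assms a) simp
    finally show ?thesis
      by (simp add: mult.commute)
  qed
  from this[of p q] this[of q p] show ?thesis
    by (simp add: norm_minus_commute abs_le_iff)
qed

text \<open>Support functions with a common bound are equi-Lipschitz, so this is the theorem of Arzela and
  Ascoli combined with the closedness of the cone.\<close>

lemma compact_support_funs_cball:
  fixes \<sigma>0 :: "'a::euclidean_space usphere \<Rightarrow>\<^sub>C real"
  shows "compact (support_funs \<inter> cball \<sigma>0 r)"
  unfolding compact_def
proof (intro allI impI)
  fix s :: "nat \<Rightarrow> 'a usphere \<Rightarrow>\<^sub>C real"
  assume s: "\<forall>n. s n \<in> support_funs \<inter> cball \<sigma>0 r"
  define M where "M = norm \<sigma>0 + \<bar>r\<bar> + 1"
  have M: "norm (s n) \<le> M" for n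
    using s norm_triangle_ineq2[of "s n" \<sigma>0]
    by (auto simp: M_def dist_norm norm_minus_commute dest!: spec[of _ n])
  have "M > 0"
    by (simp add: M_def add_nonneg_pos)
  let ?F = "\<lambda>n x. s n (Abs_usphere x)"
  have lip: "norm (?F n x - ?F n y) \<le> M * norm (x - y)"
    if "x \<in> sphere 0 1" "y \<in> sphere 0 1" for n x y
  proof -
    obtain A where "A \<in> convex_bodies" "s n = support_fun A"
      using s by (auto simp: support_funs_def)
    then have "norm (?F n x - ?F n y) \<le> norm (s n) * norm (x - y)"
      using support_fun_lipschitz[of A "Abs_usphere x" "Abs_usphere y"] that
      by (simp add: Abs_usphere_inverse)
    also have "\<dots> \<le> M * norm (x - y)"
      by (intro mult_right_mono M) simp
    finally show ?thesis .
  qed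
  have bound: "norm (?F n x) \<le> M" if "x \<in> sphere 0 1" for n x
    using order_trans[OF norm_bounded M] .
  have equi: "\<exists>d>0. \<forall>n y. y \<in> sphere 0 1 \<and> norm (x - y) < d \<longrightarrow> norm (?F n x - ?F n y) < e"
    if x: "x \<in> sphere 0 1" and "0 < e" for x e
  proof (intro exI[of _ "e / M"] conjI allI impI)
    fix n y assume y: "y \<in> sphere (0::'a) 1 \<and> norm (x - y) < e / M"
    then have "M * norm (x - y) < e"
      using \<open>M > 0\<close> by (simp add: field_simps)
    then show "norm (?F n x - ?F n y) < e"
      using lip[OF x, of y n] y by simp
  qed (use \<open>0 < e\<close> \<open>M > 0\<close> in simp)
  obtain g k where "continuous_on (sphere (0::'a) 1) g" and k: "strict_mono (k :: nat \<Rightarrow> nat)"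
    and g: "\<And>e. 0 < e \<Longrightarrow> \<exists>N. \<forall>n x. n \<ge> N \<and> x \<in> sphere 0 1 \<longrightarrow> norm (?F (k n) x - g x) < e"
    using Arzela_Ascoli[OF compact_sphere bound equi] by metis
  have "Cauchy (s \<circ> k)"
  proof (rule metric_CauchyI)
    fix e :: real assume "e > 0"
    then obtain N where N: "\<And>n x. n \<ge> N \<Longrightarrow> x \<in> sphere 0 1 \<Longrightarrow> norm (?F (k n) x - g x) < e / 4"
      using g[of "e / 4"] by auto
    have "dist (s (k m)) (s (k n)) \<le> e / 2" if "m \<ge> N" "n \<ge> N" for m n
    proof (rule dist_bound)
      fix p :: "'a usphere"
      have "Abs_usphere (dir_vec p) = p"
        by (rule dir_vec_inverse)
      then show "dist (s (k m) p) (s (k n) p) \<le> e / 2"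
        using N[OF that(1), of "dir_vec p"] N[OF that(2), of "dir_vec p"]
        by (simp add: dist_real_def abs_if split: if_splits)
    qed
    then show "\<exists>N. \<forall>m\<ge>N. \<forall>n\<ge>N. dist ((s \<circ> k) m) ((s \<circ> k) n) < e"
      using \<open>e > 0\<close> by (intro exI[of _ N]) fastforce
  qed
  then obtain l where l: "(s \<circ> k) \<longlonglongrightarrow> l"
    using Cauchy_convergent convergent_def by blast
  have "l \<in> support_funs \<inter> cball \<sigma>0 r"
    by (rule closed_sequentially[OF closed_Int[OF closed_support_funs closed_cball] _ l])
      (use s in auto)
  then show "\<exists>l\<in>support_funs \<inter> cball \<sigma>0 r. \<exists>k. strict_mono k \<and> (s \<circ> k) \<longlonglongrightarrow> l"
    using k l by auto
qed

text \<open>The hyperplane through the nearest point \<open>b\<close> orthogonal to \<open>a - b\<close> supports \<open>B\<close>, so the support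
  function of \<open>B\<close> in that direction is attained at \<open>b\<close>.\<close>

lemma support_fun_diff_nearest_point:
  fixes A B :: "'a::euclidean_space set"
  assumes A: "A \<in> convex_bodies" and B: "B \<in> convex_bodies"
    and "a \<in> A" "b \<in> B" "a \<noteq> b" and nearest: "\<And>z. z \<in> B \<Longrightarrow> norm (a - b) \<le> norm (a - z)"
  defines "p \<equiv> Abs_usphere ((a - b) /\<^sub>R norm (a - b))"
  shows "norm (a - b) \<le> support_fun A p - support_fun B p"
proof -
  have u: "dir_vec p = (a - b) /\<^sub>R norm (a - b)"
    unfolding p_def using \<open>a \<noteq> b\<close> by (intro dir_vec_Abs_normalize) simp
  have "support_fun B p \<le> dir_vec p \<bullet> b"
  proof (rule support_fun_le[OF B])
    fix z assume "z \<in> B"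
    then have "(a - b) \<bullet> (z - b) \<le> 0"
      using B \<open>b \<in> B\<close> nearest
      by (intro any_closest_point_dot[of B])
        (auto simp: convex_bodies_def dist_norm intro: compact_imp_closed)
    then have "inverse (norm (a - b)) * ((a - b) \<bullet> (z - b)) \<le> 0"
      by (simp add: mult_le_0_iff)
    then show "dir_vec p \<bullet> z \<le> dir_vec p \<bullet> b"
      unfolding u by (simp add: inner_diff_right right_diff_distrib)
  qed
  moreover have "dir_vec p \<bullet> a \<le> support_fun A p"
    by (rule inner_le_support_fun[OF A \<open>a \<in> A\<close>])
  moreover have "norm (a - b) = dir_vec p \<bullet> a - dir_vec p \<bullet> b"
    unfolding u inner_diff_right[symmetric] by (rule inner_normalize_self[symmetric])
  ultimately show ?thesis
    by linarith
qed

lemma excess_singleton_le: "b \<in> B \<Longrightarrow> excess {a} B \<le> norm (a - b)"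
  unfolding excess_def by (auto intro!: cINF_lower bdd_belowI2[of _ 0])

lemma excess_singleton_attained:
  assumes "B \<in> convex_bodies"
  obtains b where "b \<in> B" "excess {a} B = norm (a - b)"
proof -
  have B: "closed B" "B \<noteq> {}"
    using assms by (auto simp: convex_bodies_def compact_imp_closed)
  let ?b = "closest_point B a"
  have "?b \<in> B"
    using closest_point_in_set[OF B] .
  moreover have "norm (a - ?b) \<le> excess {a} B"
    unfolding excess_def using B closest_point_le[OF B(1)] 
    by (auto intro!: cINF_greatest simp: dist_norm)
  ultimately show thesis
    using that excess_singleton_le by (metis antisym)
qed

lemma
  assumes A: "A \<in> convex_bodies" and B: "B \<in> convex_bodies"
  shows excess_le_norm_diff: "excess A B \<le> norm (support_fun A - support_fun B)"
    and support_fun_diff_le_excess: "support_fun A p - support_fun B p \<le> excess A B"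
proof -
  have excess_eq: "excess A B = (SUP a\<in>A. excess {a} B)"
    by (simp add: excess_def)
  have le: "excess {a} B \<le> norm (support_fun A - support_fun B)" if "a \<in> A" for a
  proof -
    obtain b where b: "b \<in> B" "excess {a} B = norm (a - b)"
      using excess_singleton_attained[OF B] .
    show ?thesis
    proof (cases "a = b")
      case False
      let ?p = "Abs_usphere ((a - b) /\<^sub>R norm (a - b))"
      have "excess {a} B \<le> (support_fun A - support_fun B) ?p"
        unfolding minus_bcontfun.rep_eq b(2)
        by (rule support_fun_diff_nearest_point[OF A B that b(1) False])
          (metis b(2) excess_singleton_le)
      then show ?thesis
        using norm_bounded[of "support_fun A - support_fun B" ?p] by simp
    qed (use b in simp)
  qed
  then show "excess A B \<le> norm (support_fun A - support_fun B)"
    unfolding excess_eq using A by (auto simp: convex_bodies_def intro!: cSUP_least)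
  obtain a where a: "a \<in> A" "support_fun A p = dir_vec p \<bullet> a"
    using support_fun_attained[OF A] .
  obtain b where b: "b \<in> B" "excess {a} B = norm (a - b)"
    using excess_singleton_attained[OF B] .
  have "support_fun A p - support_fun B p \<le> dir_vec p \<bullet> (a - b)"
    using a inner_le_support_fun[OF B b(1), of p] by (simp add: inner_diff_right)
  also have "\<dots> \<le> excess {a} B"
    using norm_cauchy_schwarz[of "dir_vec p" "a - b"] b by simp
  also have "\<dots> \<le> excess A B"
    unfolding excess_eq using le by (intro cSUP_upper a bdd_aboveI2) 
  finally show "support_fun A p - support_fun B p \<le> excess A B" .
qed

lemma hausdorff_dist_eq_norm:
  assumes "A \<in> convex_bodies" "B \<in> convex_bodies"
  shows "hausdorff_dist A B = norm (support_fun A - support_fun B)"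
proof (rule antisym)
  show "hausdorff_dist A B \<le> norm (support_fun A - support_fun B)"
    using assms excess_le_norm_diff[of A B] excess_le_norm_diff[of B A]
    by (simp add: hausdorff_dist_def norm_minus_commute)
  show "norm (support_fun A - support_fun B) \<le> hausdorff_dist A B"
  proof (rule norm_bound)
    fix p
    show "norm ((support_fun A - support_fun B) p) \<le> hausdorff_dist A B"
      using support_fun_diff_le_excess[OF assms, of p] support_fun_diff_le_excess[OF assms(2,1), of p]
      by (simp add: hausdorff_dist_def)
  qed
qed

section \<open>Viability of convex sets under tangential vector fields\<close>

text \<open>Tychonoff's theorem in the form of a limit along a filter finer than \<^const>\<open>sequentially\<close>. The
  filter takes the place of a subsequence that would converge at all indices simultaneously and that
  need not exist when there are uncountably many of them.\<close>

lemma cluster_function_compact: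
  fixes u :: "nat \<Rightarrow> 'i \<Rightarrow> 'b::topological_space"
  assumes "compact K" and u: "\<And>n i. u n i \<in> K"
  obtains G and x where "G \<le> sequentially" "G \<noteq> bot"
    "\<And>i. x i \<in> K" "\<And>i. ((\<lambda>n. u n i) \<longlongrightarrow> x i) G"
proof -
  let ?P = "PiE UNIV (\<lambda>_. K) :: ('i \<Rightarrow> 'b) set"
  have "compactin (product_topology (\<lambda>_. euclidean) UNIV) ?P"
    using \<open>compact K\<close> by (simp add: compactin_PiE)
  then have "compact ?P"
    by (simp add: euclidean_product_topology)
  moreover have "\<forall>\<^sub>F v in filtermap u sequentially. v \<in> ?P"
    using u by (auto simp: eventually_filtermap PiE_iff)
  ultimately obtain x where x: "x \<in> ?P" "inf (nhds x) (filtermap u sequentially) \<noteq> bot"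
    unfolding compact_filter by (metis filtermap_bot_iff trivial_limit_sequentially)
  let ?G = "inf sequentially (filtercomap u (nhds x))"
  have "?G \<noteq> bot"
  proof
    assume "?G = bot"
    then have "eventually (\<lambda>_. False) ?G"
      by simp
    then obtain Q R where "eventually Q sequentially" "eventually R (nhds x)" "\<And>n. Q n \<Longrightarrow> \<not> R (u n)"
      unfolding eventually_inf eventually_filtercomap by blast
    moreover from this have "eventually (\<lambda>v. \<not> R v) (filtermap u sequentially)"
      unfolding eventually_filtermap by (auto elim: eventually_mono)
    ultimately have "eventually (\<lambda>_. False) (inf (nhds x) (filtermap u sequentially))"
      unfolding eventually_inf by blast
    with x(2) show False
      by (simp add: trivial_limit_def)
  qed
  moreover have "((\<lambda>n. u n i) \<longlongrightarrow> x i) ?G" for i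
  proof -
    have "filterlim u (nhds x) ?G"
      by (rule filterlim_mono[OF filterlim_filtercomap order_refl inf_le2])
    from continuous_on_tendsto_compose[OF continuous_on_product_coordinates this]
    show ?thesis
      by simp
  qed
  ultimately show thesis
    using that[of ?G x] x(1) by auto
qed

text \<open>At a single point, tangency provides a good step, and by convexity every shorter step is good as
  well. A step that is good at a limit point, when started from nearby points but aimed at the same
  target \<open>y\<close>, is good at these too; by compactness one step size then serves all points. The aim
  \<open>\<mu> (y - x)\<close> may exceed the bound \<open>c\<close> slightly, which a contraction by \<open>\<theta>\<close> close to 1 corrects,
  again without leaving the convex set.\<close>

lemma uniform_tangent_step:
  fixes f :: "'t::metric_space \<Rightarrow> 'b::real_normed_vector \<Rightarrow> 'b"
  assumes "convex C" "compact (I \<times> D)" "D \<subseteq> C"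
    and cont: "continuous_on (I \<times> D) (\<lambda>(t, x). f t x)"
    and tangent: "\<And>t x. t \<in> I \<Longrightarrow> x \<in> D \<Longrightarrow> f t x \<in> closure {\<mu> *\<^sub>R (y - x) | y \<mu>. y \<in> C \<and> 0 \<le> \<mu>}"
    and "0 < c" and bound: "\<And>t x. t \<in> I \<Longrightarrow> x \<in> D \<Longrightarrow> norm (f t x) \<le> c"
    and "0 < \<epsilon>"
  shows "\<exists>h0>0. \<forall>t\<in>I. \<forall>x\<in>D. \<forall>h\<in>{0<..h0}. \<exists>g. norm g \<le> c \<and> norm (g - f t x) \<le> \<epsilon> \<and> x + h *\<^sub>R g \<in> C"
proof (rule ccontr)
  assume "\<not> ?thesis"
  then have "\<exists>t\<in>I. \<exists>x\<in>D. \<exists>h\<in>{0<..1 / Suc n}. \<forall>g. \<not> (norm g \<le> c \<and> norm (g - f t x) \<le> \<epsilon> \<and> x + h *\<^sub>R g \<in> C)" for n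
    by (metis divide_pos_pos of_nat_0_less_iff zero_less_Suc zero_less_one)
  then obtain t x h where tx: "\<And>n. t n \<in> I" "\<And>n. x n \<in> D" and h: "\<And>n. h n \<in> {0<..1 / Suc n}"
    and no_step: "\<And>n g. norm g \<le> c \<Longrightarrow> norm (g - f (t n) (x n)) \<le> \<epsilon> \<Longrightarrow> x n + h n *\<^sub>R g \<notin> C"
    by metis
  obtain l k where l: "l \<in> I \<times> D" and k: "strict_mono k" "((\<lambda>n. (t n, x n)) \<circ> k) \<longlonglongrightarrow> l"
    using \<open>compact (I \<times> D)\<close> tx unfolding compact_def by (metis (no_types, lifting) SigmaI)
  obtain s z where l_eq: "l = (s, z)"
    by (cases l)
  have sz: "s \<in> I" "z \<in> D"
    using l l_eq by auto
  have lim_x: "(\<lambda>n. x (k n)) \<longlonglongrightarrow> z"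
    using tendsto_snd[OF k(2)] by (simp add: o_def l_eq)
  have lim_f: "(\<lambda>n. f (t (k n)) (x (k n))) \<longlonglongrightarrow> f s z"
    using continuous_on_tendsto_compose[OF cont k(2) l] tx by (simp add: o_def l_eq)
  have "0 \<le> h n" "h n \<le> inverse (Suc n)" for n
    using h[of n] by (simp_all add: inverse_eq_divide)
  then have "h \<longlonglongrightarrow> 0"
    by (intro tendsto_sandwich[OF _ _ tendsto_const LIMSEQ_inverse_real_of_nat] always_eventually allI)
  then have lim_h: "(\<lambda>n. h (k n)) \<longlonglongrightarrow> 0"
    using LIMSEQ_subseq_LIMSEQ[OF _ k(1)] by (auto simp: o_def)
  \<comment> \<open>Three approximations are made with error \<open>e\<close>, and the contraction by \<open>\<theta>\<close> doubles their sum.\<close>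
  define e where "e = \<epsilon> / 6"
  have "e > 0"
    using \<open>0 < \<epsilon>\<close> by (simp add: e_def)
  obtain y \<mu> where y: "y \<in> C" "0 \<le> \<mu>" "dist (\<mu> *\<^sub>R (y - z)) (f s z) < e"
    using tangent[OF sz] \<open>e > 0\<close> unfolding closure_approachable by blast
  have "(\<lambda>n. \<mu> *\<^sub>R (y - x (k n))) \<longlonglongrightarrow> \<mu> *\<^sub>R (y - z)"
    by (intro tendsto_intros lim_x)
  then have "\<forall>\<^sub>F n in sequentially. dist (\<mu> *\<^sub>R (y - x (k n))) (\<mu> *\<^sub>R (y - z)) < e"
    using \<open>e > 0\<close> by (rule tendstoD)
  moreover have "\<forall>\<^sub>F n in sequentially. dist (f (t (k n)) (x (k n))) (f s z) < e"
    using lim_f \<open>e > 0\<close> by (rule tendstoD)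
  moreover have "\<forall>\<^sub>F n in sequentially. h (k n) * \<mu> < 1"
    using order_tendstoD(2)[OF tendsto_mult_left_zero[OF lim_h], of 1 \<mu>] by simp
  ultimately have "\<forall>\<^sub>F n in sequentially. False"
  proof eventually_elim
    case (elim n)
    define v where "v = \<mu> *\<^sub>R (y - x (k n))"
    define w where "w = f (t (k n)) (x (k n))"
    define \<theta> where "\<theta> = c / (c + 3 * e)"
    have \<theta>: "0 \<le> \<theta>" "\<theta> \<le> 1" "\<theta> * (c + 3 * e) = c"
      using \<open>0 < c\<close> \<open>e > 0\<close> by (auto simp: \<theta>_def)
    have vw: "norm (v - w) \<le> 3 * e"
    proof -
      have "dist v w \<le> dist v (\<mu> *\<^sub>R (y - z)) + dist (\<mu> *\<^sub>R (y - z)) (f s z) + dist w (f s z)"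
        using dist_triangle[of v w "\<mu> *\<^sub>R (y - z)"] dist_triangle[of "\<mu> *\<^sub>R (y - z)" w "f s z"]
        by (simp add: dist_commute)
      then show ?thesis
        using elim y(3) unfolding v_def w_def by (simp add: dist_norm)
    qed
    have "norm w \<le> c"
      unfolding w_def by (rule bound[OF tx])
    then have norm_v: "norm v \<le> c + 3 * e"
      using vw norm_triangle_ineq2[of v w] by linarith
    have "norm (\<theta> *\<^sub>R v) \<le> c"
      using mult_left_mono[OF norm_v \<theta>(1)] \<theta> by simp
    moreover have "norm (\<theta> *\<^sub>R v - w) \<le> \<epsilon>"
    proof -
      have "norm (\<theta> *\<^sub>R v - v) = (1 - \<theta>) * norm v"
        using \<theta> by (simp add: scaleR_left_diff_distrib[of \<theta> 1 v, simplified, symmetric])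
      also have "\<dots> \<le> (1 - \<theta>) * (c + 3 * e)"
        using norm_v \<theta> by (intro mult_left_mono) auto
      also have "\<dots> = 3 * e"
        using \<theta> by (simp add: algebra_simps)
      finally show ?thesis
        using vw norm_triangle_ineq[of "\<theta> *\<^sub>R v - v" "v - w"] by (simp add: e_def)
    qed
    moreover have "x (k n) + h (k n) *\<^sub>R (\<theta> *\<^sub>R v) \<in> C"
    proof -
      define \<eta> where "\<eta> = h (k n) * \<theta> * \<mu>"
      have "h (k n) * \<mu> * \<theta> \<le> 1 * 1"
        using elim h[of "k n"] \<theta> y(2) by (intro mult_mono) auto
      then have "\<eta> \<le> 1" "0 \<le> \<eta>"
        using h[of "k n"] \<theta> y(2) by (auto simp: \<eta>_def mult_ac)
      moreover have "x (k n) + h (k n) *\<^sub>R (\<theta> *\<^sub>R v) = (1 - \<eta>) *\<^sub>R x (k n) + \<eta> *\<^sub>R y"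
        by (simp add: v_def \<eta>_def algebra_simps)
      ultimately show ?thesis
        using convexD[OF \<open>convex C\<close>, of "x (k n)" y "1 - \<eta>" \<eta>] tx y(1) \<open>D \<subseteq> C\<close> by auto
    qed
    ultimately show False
      using no_step w_def by blast
  qed
  then show False
    by simp
qed

lemma euler_chain:
  fixes f :: "real \<Rightarrow> 'b::real_normed_vector \<Rightarrow> 'b"
  assumes "x0 \<in> C" "0 < h" "0 \<le> c" "real N * h \<le> T" "real N * h * c \<le> r"
    and step: "\<And>t x. t \<in> {0..T} \<Longrightarrow> x \<in> C \<inter> cball x0 r \<Longrightarrow>
      \<exists>g. norm g \<le> c \<and> norm (g - f t x) \<le> \<epsilon> \<and> x + h *\<^sub>R g \<in> C"
  obtains x where "x 0 = x0" "\<And>k. k \<le> N \<Longrightarrow> x k \<in> C \<inter> cball x0 r"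
    "\<And>k. k < N \<Longrightarrow> norm (x (Suc k) - x k) \<le> h * c"
    "\<And>k. k < N \<Longrightarrow> norm (x (Suc k) - x k - h *\<^sub>R f (k * h) (x k)) \<le> h * \<epsilon>"
proof -
  obtain g where g: "\<And>t x. t \<in> {0..T} \<Longrightarrow> x \<in> C \<inter> cball x0 r \<Longrightarrow>
      norm (g t x) \<le> c \<and> norm (g t x - f t x) \<le> \<epsilon> \<and> x + h *\<^sub>R g t x \<in> C"
    using step by metis
  define x where "x = rec_nat x0 (\<lambda>k y. y + h *\<^sub>R g (k * h) y)"
  have x_0: "x 0 = x0" and x_Suc: "\<And>k. x (Suc k) = x k + h *\<^sub>R g (k * h) (x k)"
    by (simp_all add: x_def)
  have time: "real k * h \<in> {0..T}" if "k \<le> N" for k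
  proof -
    have "real k * h \<le> real N * h"
      using that \<open>0 < h\<close> by (intro mult_right_mono) auto
    then have "real k * h \<le> T"
      using \<open>real N * h \<le> T\<close> by linarith
    then show ?thesis
      using \<open>0 < h\<close> by simp
  qed
  have ball: "x \<in> cball x0 r" if "norm (x - x0) \<le> real k * h * c" "k \<le> N" for x k
  proof -
    have "real k * h * c \<le> real N * h * c"
      using that(2) \<open>0 < h\<close> \<open>0 \<le> c\<close> by (intro mult_right_mono) auto
    then show ?thesis
      using that \<open>real N * h * c \<le> r\<close> by (simp add: dist_norm norm_minus_commute)
  qed
  have inv: "x k \<in> C \<and> norm (x k - x0) \<le> real k * h * c" if "k \<le> N" for k
    using that
  proof (induction k)
    case 0
    then show ?case
      using \<open>x0 \<in> C\<close> by (simp add: x_0)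
  next
    case (Suc k)
    then have IH: "x k \<in> C" "norm (x k - x0) \<le> real k * h * c" and "k \<le> N"
      by auto
    note gk = g[OF time[OF \<open>k \<le> N\<close>] IntI[OF IH(1) ball[OF IH(2) \<open>k \<le> N\<close>]]]
    have "norm (x (Suc k) - x0) \<le> norm (x k - x0) + norm (h *\<^sub>R g (k * h) (x k))"
      using norm_triangle_ineq[of "x k - x0" "h *\<^sub>R g (k * h) (x k)"]
      by (simp add: x_Suc algebra_simps)
    also have "norm (h *\<^sub>R g (k * h) (x k)) \<le> h * c"
      using gk \<open>0 < h\<close> by simp
    finally have "norm (x (Suc k) - x0) \<le> real (Suc k) * h * c"
      using IH(2) by (simp add: algebra_simps)
    then show ?case
      using gk by (simp add: x_Suc)
  qed
  have mem: "x k \<in> C \<inter> cball x0 r" if "k \<le> N" for k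
    using inv[OF that] ball that by blast
  show thesis
  proof (rule that[of x])
    fix k assume "k < N"
    then have gk: "norm (g (k * h) (x k)) \<le> c" "norm (g (k * h) (x k) - f (k * h) (x k)) \<le> \<epsilon>"
      using g[OF time mem] by auto
    show "norm (x (Suc k) - x k) \<le> h * c"
      using gk(1) \<open>0 < h\<close> by (simp add: x_Suc)
    have "x (Suc k) - x k - h *\<^sub>R f (k * h) (x k) = h *\<^sub>R (g (k * h) (x k) - f (k * h) (x k))"
      by (simp add: x_Suc algebra_simps)
    then show "norm (x (Suc k) - x k - h *\<^sub>R f (k * h) (x k)) \<le> h * \<epsilon>"
      using gk(2) \<open>0 < h\<close> by simp
  qed (use x_0 mem in auto)
qed

text \<open>Summation of the one-step errors. The same lemma with \<open>F = 0\<close> yields the Lipschitz bound of a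
  chain.\<close>

lemma euler_chain_increment:
  fixes F :: "nat \<Rightarrow> 'b::real_normed_vector"
  assumes "k \<le> j" and "0 \<le> h"
    and step: "\<And>i. k \<le> i \<Longrightarrow> i < j \<Longrightarrow> norm (x (Suc i) - x i - h *\<^sub>R F i) \<le> h * \<epsilon>"
    and close: "\<And>i. k \<le> i \<Longrightarrow> i < j \<Longrightarrow> norm (F i - F k) \<le> e"
  shows "norm (x j - x k - (real j * h - real k * h) *\<^sub>R F k) \<le> (\<epsilon> + e) * (real j * h - real k * h)"
  using \<open>k \<le> j\<close> step close
proof (induction j rule: dec_induct)
  case base
  then show ?case by simp
next
  case (step i)
  let ?r = "x i - x k - (real i * h - real k * h) *\<^sub>R F k"
  have "x (Suc i) - x k - (real (Suc i) * h - real k * h) *\<^sub>R F k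
      = ?r + (x (Suc i) - x i - h *\<^sub>R F i) + h *\<^sub>R (F i - F k)"
    by (simp add: algebra_simps)
  also have "norm \<dots> \<le> norm ?r + norm (x (Suc i) - x i - h *\<^sub>R F i) + norm (h *\<^sub>R (F i - F k))"
    by (intro norm_triangle_le add_right_mono norm_triangle_ineq order_refl)
  also have "\<dots> \<le> (\<epsilon> + e) * (real i * h - real k * h) + h * \<epsilon> + h * e"
    using step.prems step.hyps \<open>0 \<le> h\<close> by (intro add_mono step.IH) (auto intro: mult_left_mono)
  finally show ?case
    by (simp add: algebra_simps)
qed

text \<open>A forward estimate that is uniform in the base point gives the derivative from the left as well,
  since \<open>F\<close> may be moved from the left end point to \<open>t\<close> by continuity.\<close>

lemma has_vector_derivative_of_increments:
  fixes u :: "real \<Rightarrow> 'b::real_normed_vector"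
  assumes cont: "continuous_on {a..b} F"
    and incr: "\<And>e. 0 < e \<Longrightarrow> \<exists>\<delta>>0. \<forall>s\<in>{a..b}. \<forall>t\<in>{a..b}. s \<le> t \<and> t - s < \<delta> \<longrightarrow>
      norm (u t - u s - (t - s) *\<^sub>R F s) \<le> e * (t - s)"
    and t: "t \<in> {a<..<b}"
  shows "(u has_vector_derivative F t) (at t)"
  unfolding has_vector_derivative_def has_derivative_at_alt
proof (intro conjI allI impI bounded_linear_scaleR_left)
  fix e :: real assume "e > 0"
  then obtain \<delta> where "\<delta> > 0" and \<delta>: "\<And>s t. s \<in> {a..b} \<Longrightarrow> t \<in> {a..b} \<Longrightarrow> s \<le> t \<Longrightarrow> t - s < \<delta> \<Longrightarrow>
      norm (u t - u s - (t - s) *\<^sub>R F s) \<le> e / 2 * (t - s)"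
    using incr[of "e / 2"] by auto
  have "t \<in> {a..b}" "0 < e / 2"
    using t \<open>e > 0\<close> by auto
  then obtain d where "d > 0" and d: "\<And>s. s \<in> {a..b} \<Longrightarrow> \<bar>s - t\<bar> < d \<Longrightarrow> norm (F s - F t) < e / 2"
    using cont unfolding continuous_on_iff dist_norm real_norm_def by blast
  show "\<exists>d>0. \<forall>y. norm (y - t) < d \<longrightarrow> norm (u y - u t - (y - t) *\<^sub>R F t) \<le> e * norm (y - t)"
  proof (intro exI[of _ "min (min \<delta> d) (min (t - a) (b - t))"] conjI allI impI)
    fix y assume y: "norm (y - t) < min (min \<delta> d) (min (t - a) (b - t))"
    then have y_ab: "y \<in> {a..b}" and t_ab: "t \<in> {a..b}"
      by (auto simp: abs_less_iff)
    show "norm (u y - u t - (y - t) *\<^sub>R F t) \<le> e * norm (y - t)"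
    proof (cases "t \<le> y")
      case True
      then have "norm (u y - u t - (y - t) *\<^sub>R F t) \<le> e / 2 * (y - t)"
        using \<delta>[OF t_ab y_ab] y by simp
      also have "\<dots> \<le> e * norm (y - t)"
        using True \<open>e > 0\<close> by (intro mult_mono) auto
      finally show ?thesis .
    next
      case False
      have "u y - u t - (y - t) *\<^sub>R F t = - (u t - u y - (t - y) *\<^sub>R F y) - (t - y) *\<^sub>R (F y - F t)"
        by (simp add: algebra_simps)
      also have "norm \<dots> \<le> norm (u t - u y - (t - y) *\<^sub>R F y) + (t - y) * norm (F y - F t)"
        using norm_triangle_ineq4[of "- (u t - u y - (t - y) *\<^sub>R F y)" "(t - y) *\<^sub>R (F y - F t)"] False
        unfolding norm_minus_cancel by simp
      also have "\<dots> \<le> e / 2 * (t - y) + (t - y) * (e / 2)"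
        using False y \<delta>[OF y_ab t_ab] d[OF y_ab] by (intro add_mono mult_left_mono) auto
      finally show ?thesis
        using False by (simp add: algebra_simps)
    qed
  qed (use \<open>\<delta> > 0\<close> \<open>d > 0\<close> t in auto)
qed

lemma nat_floor_mesh:
  fixes t h :: real
  assumes "0 < h" "0 \<le> t" "t \<le> real N * h"
  shows "nat \<lfloor>t / h\<rfloor> \<le> N" "\<bar>real (nat \<lfloor>t / h\<rfloor>) * h - t\<bar> \<le> h"
proof -
  let ?k = "nat \<lfloor>t / h\<rfloor>"
  have k: "real ?k \<le> t / h" "t / h < real ?k + 1"
    using assms by (auto simp: floor_correct)
  have "t / h \<le> real N"
    using assms by (simp add: field_simps)
  then have "real ?k \<le> real N"
    using k(1) by (rule order_trans[rotated])
  then show "?k \<le> N"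
    by simp
  show "\<bar>real ?k * h - t\<bar> \<le> h"
    using k \<open>0 < h\<close> by (simp add: field_simps abs_le_iff)
qed

text \<open>The Euler chains are interpolated by step functions rather than by polygons: their jumps vanish
  in the limit, and the step functions take values in the compact set at all times. The solution is a
  pointwise cluster function; the increment estimates of the chains pass to it for each pair of times
  separately, and continuity and differentiability follow from these estimates.\<close>

theorem convex_viability:
  fixes f :: "real \<Rightarrow> 'b::real_normed_vector \<Rightarrow> 'b"
  assumes "convex C" and compact: "compact (C \<inter> cball x0 r)" and "x0 \<in> C"
    and "0 < T" "0 < r" "0 < c"
    and cont: "continuous_on ({0..T} \<times> (C \<inter> cball x0 r)) (\<lambda>(t, x). f t x)"
    and tangent: "\<And>t x. t \<in> {0..T} \<Longrightarrow> x \<in> C \<inter> cball x0 r \<Longrightarrow>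
      f t x \<in> closure {\<mu> *\<^sub>R (y - x) | y \<mu>. y \<in> C \<and> 0 \<le> \<mu>}"
    and bound: "\<And>t x. t \<in> {0..T} \<Longrightarrow> x \<in> C \<inter> cball x0 r \<Longrightarrow> norm (f t x) \<le> c"
  defines "\<beta> \<equiv> min T (r / c)"
  obtains u where "continuous_on {0..\<beta>} u" "u ` {0..\<beta>} \<subseteq> C \<inter> cball x0 r" "u 0 = x0"
    "\<And>t. t \<in> {0<..<\<beta>} \<Longrightarrow> (u has_vector_derivative f t (u t)) (at t)"
proof -
  define D where "D = C \<inter> cball x0 r"
  have compact_ID: "compact ({0..T} \<times> D)"
    using compact unfolding D_def by (intro compact_Times) auto
  have \<beta>: "0 < \<beta>" "\<beta> \<le> T" "\<beta> * c \<le> r"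
    using \<open>0 < T\<close> \<open>0 < r\<close> \<open>0 < c\<close> by (auto simp: \<beta>_def min_def field_simps)
  have "\<exists>N x. 0 < N \<and> \<beta> / real N \<le> 1 / Suc n \<and> x 0 = x0 \<and> (\<forall>k\<le>N. x k \<in> D) \<and>
      (\<forall>k<N. norm (x (Suc k) - x k) \<le> \<beta> / N * c) \<and>
      (\<forall>k<N. norm (x (Suc k) - x k - (\<beta> / N) *\<^sub>R f (k * (\<beta> / N)) (x k)) \<le> \<beta> / N * (1 / Suc n))" for n
  proof -
    obtain h0 where "0 < h0" and h0: "\<And>t x h. t \<in> {0..T} \<Longrightarrow> x \<in> D \<Longrightarrow> h \<in> {0<..h0} \<Longrightarrow>
        \<exists>g. norm g \<le> c \<and> norm (g - f t x) \<le> 1 / Suc n \<and> x + h *\<^sub>R g \<in> C"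
      using uniform_tangent_step[OF \<open>convex C\<close> compact_ID _ cont[folded D_def]
          tangent[folded D_def] \<open>0 < c\<close> bound[folded D_def], of "1 / Suc n"]
      by (auto simp: D_def)
    obtain N where N: "0 < N" "inverse (real N) < min h0 (1 / Suc n) / \<beta>"
      using ex_inverse_of_nat_less[of "min h0 (1 / Suc n) / \<beta>"] \<open>0 < h0\<close> \<beta>(1) by auto
    define h where "h = \<beta> / N"
    have h: "0 < h" "h \<le> h0" "h \<le> 1 / Suc n" "real N * h = \<beta>"
      using N \<beta>(1) by (auto simp: h_def field_simps)
    obtain x where "x 0 = x0" "\<And>k. k \<le> N \<Longrightarrow> x k \<in> C \<inter> cball x0 r"
      "\<And>k. k < N \<Longrightarrow> norm (x (Suc k) - x k) \<le> h * c"
      "\<And>k. k < N \<Longrightarrow> norm (x (Suc k) - x k - h *\<^sub>R f (k * h) (x k)) \<le> h * (1 / Suc n)"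
      using euler_chain[of x0 C h c N T r f "1 / Suc n"] \<open>x0 \<in> C\<close> \<open>0 < c\<close> h \<beta> h0[of _ _ h]
      unfolding D_def by (metis greaterThanAtMost_iff less_imp_le)
    then show ?thesis
      using N(1) h(3) unfolding D_def h_def by blast
  qed
  then obtain N x where N: "\<And>n. 0 < N n" "\<And>n. \<beta> / real (N n) \<le> 1 / Suc n"
    and x_0: "\<And>n. x n 0 = x0" and x_mem: "\<And>n k. k \<le> N n \<Longrightarrow> x n k \<in> D"
    and x_lip: "\<And>n k. k < N n \<Longrightarrow> norm (x n (Suc k) - x n k) \<le> \<beta> / N n * c"
    and x_step: "\<And>n k. k < N n \<Longrightarrow>
      norm (x n (Suc k) - x n k - (\<beta> / N n) *\<^sub>R f (k * (\<beta> / N n)) (x n k)) \<le> \<beta> / N n * (1 / Suc n)"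
    by metis
  define h where "h n = \<beta> / N n" for n
  have h: "0 < h n" "h n \<le> 1 / Suc n" "real (N n) * h n = \<beta>" for n
    using N[of n] \<beta>(1) by (auto simp: h_def)
  \<comment> \<open>Clamping the time makes every index valid, so that the step functions map the whole real line
      into the compact set, as the cluster argument requires.\<close>
  define cell where "cell n t = nat \<lfloor>max 0 (min \<beta> t) / h n\<rfloor>" for n t
  have cell_le: "cell n t \<le> N n" for n t
    unfolding cell_def using h[of n] \<beta>(1) by (intro nat_floor_mesh(1)) auto
  have cell_time: "\<bar>real (cell n t) * h n - t\<bar> \<le> h n" if "t \<in> {0..\<beta>}" for n t
    using nat_floor_mesh(2)[of "h n" t "N n"] h[of n] that by (simp add: cell_def)
  have cell_mono: "cell n s \<le> cell n t" if "s \<le> t" for n s t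
    unfolding cell_def using that h[of n] by (intro nat_mono floor_mono divide_right_mono) auto
  obtain G u where G: "G \<le> sequentially" "G \<noteq> bot" and u_mem: "\<And>t. u t \<in> D"
    and u_lim: "\<And>t. ((\<lambda>n. x n (cell n t)) \<longlongrightarrow> u t) G"
    using cluster_function_compact[of D "\<lambda>n t. x n (cell n t)"] compact x_mem[OF cell_le]
    unfolding D_def by blast
  have G_inv: "((\<lambda>n. 1 / real (Suc n)) \<longlongrightarrow> 0) G"
    using LIMSEQ_inverse_real_of_nat tendsto_mono[OF G(1)] by (simp add: inverse_eq_divide)
  have h_lim: "(h \<longlongrightarrow> 0) G"
    by (rule tendsto_sandwich[OF _ _ tendsto_const G_inv])
      (use h in \<open>auto intro!: always_eventually less_imp_le\<close>)
  have time_lim: "((\<lambda>n. real (cell n t) * h n) \<longlongrightarrow> t) G" if "t \<in> {0..\<beta>}" for t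
    by (rule LIM_zero_cancel, rule Lim_null_comparison[OF _ h_lim])
      (use cell_time[OF that] in \<open>auto intro!: always_eventually\<close>)
  have chain_time: "real k * h n \<in> {0..T}" if "k \<le> N n" for k n
  proof -
    have "real k * h n \<le> real (N n) * h n"
      using that h[of n] by (intro mult_right_mono) auto
    then have "real k * h n \<le> T"
      using h(3)[of n] \<beta>(2) by linarith
    then show ?thesis
      using h(1)[of n] by simp
  qed
  have chain_lip: "norm (x n j - x n k) \<le> c * (real j * h n - real k * h n)" if "k \<le> j" "j \<le> N n" for n k j
    using euler_chain_increment[of k j "h n" "x n" "\<lambda>_. 0" c 0] x_lip[of _ n] that h(1)[of n]
    by (auto simp: h_def)
  have lip: "norm (u t - u s) \<le> c * (t - s)" if st: "s \<in> {0..\<beta>}" "t \<in> {0..\<beta>}" "s \<le> t" for s t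
  proof (rule tendsto_le[OF G(2)])
    show "((\<lambda>n. norm (x n (cell n t) - x n (cell n s))) \<longlongrightarrow> norm (u t - u s)) G"
      by (intro tendsto_intros u_lim)
    show "((\<lambda>n. c * (real (cell n t) * h n - real (cell n s) * h n)) \<longlongrightarrow> c * (t - s)) G"
      by (intro tendsto_intros time_lim st)
    show "\<forall>\<^sub>F n in G. norm (x n (cell n t) - x n (cell n s)) \<le> c * (real (cell n t) * h n - real (cell n s) * h n)"
      by (intro always_eventually allI chain_lip cell_mono st cell_le)
  qed
  have cont_u: "continuous_on {0..\<beta>} u"
  proof (rule lipschitz_on_continuous_on, rule lipschitz_onI)
    fix s t assume "s \<in> {0..\<beta>}" "t \<in> {0..\<beta>}"
    then show "dist (u s) (u t) \<le> c * dist s t"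
      using lip[of s t] lip[of t s] by (cases "s \<le> t") (auto simp: dist_norm norm_minus_commute)
  qed (use \<open>0 < c\<close> in simp)
  have "(\<lambda>t. (t, u t)) ` {0..\<beta>} \<subseteq> {0..T} \<times> D"
    using u_mem \<beta>(2) by auto
  then have cont_F: "continuous_on {0..\<beta>} (\<lambda>t. f t (u t))"
    using continuous_on_compose2[OF cont[folded D_def] continuous_on_Pair[OF continuous_on_id cont_u]]
    by simp
  have F_lim: "((\<lambda>n. f (cell n t * h n) (x n (cell n t))) \<longlongrightarrow> f t (u t)) G" if "t \<in> {0..\<beta>}" for t
  proof -
    have "((\<lambda>n. (\<lambda>(t, x). f t x) (cell n t * h n, x n (cell n t))) \<longlongrightarrow> (\<lambda>(t, x). f t x) (t, u t)) G"
      by (rule continuous_on_tendsto_compose[OF cont[folded D_def] tendsto_Pair[OF time_lim[OF that] u_lim]])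
        (use that u_mem \<beta>(2) chain_time[OF cell_le] x_mem[OF cell_le] in auto)
    then show ?thesis
      by simp
  qed
  have increments: "\<exists>\<delta>>0. \<forall>s\<in>{0..\<beta>}. \<forall>t\<in>{0..\<beta>}. s \<le> t \<and> t - s < \<delta> \<longrightarrow>
      norm (u t - u s - (t - s) *\<^sub>R f s (u s)) \<le> e * (t - s)" if "0 < e" for e
  proof -
    have "uniformly_continuous_on ({0..T} \<times> D) (\<lambda>(t, x). f t x)"
      by (rule compact_uniformly_continuous[OF cont[folded D_def] compact_ID])
    then obtain d where "0 < d" and d: "\<And>t x t' x'. t \<in> {0..T} \<Longrightarrow> x \<in> D \<Longrightarrow> t' \<in> {0..T} \<Longrightarrow> x' \<in> D \<Longrightarrow>
        dist (t', x') (t, x) < d \<Longrightarrow> dist (f t' x') (f t x) < e"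
      using \<open>0 < e\<close> unfolding uniformly_continuous_on_def by (metis (no_types, lifting) SigmaI case_prod_conv)
    \<comment> \<open>Within a time span \<open>\<delta>\<close> a chain moves by at most \<open>c * \<delta>\<close>, so the pair of time and state
        moves by at most \<open>(1 + c) * \<delta>\<close>.\<close>
    define \<delta> where "\<delta> = d / (1 + c)"
    have "0 < \<delta>"
      using \<open>0 < d\<close> \<open>0 < c\<close> by (simp add: \<delta>_def)
    have chain: "norm (x n j - x n k - (real j * h n - real k * h n) *\<^sub>R f (k * h n) (x n k))
        \<le> (1 / Suc n + e) * (real j * h n - real k * h n)"
      if kj: "k \<le> j" "j \<le> N n" and short: "real j * h n - real k * h n < \<delta>" for n k j
    proof (rule euler_chain_increment[where F = "\<lambda>i. f (i * h n) (x n i)"])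
      fix i assume i: "k \<le> i" "i < j"
      then show "norm (x n (Suc i) - x n i - h n *\<^sub>R f (i * h n) (x n i)) \<le> h n * (1 / Suc n)"
        using x_step[of i n] kj by (simp add: h_def)
      have "real i * h n \<le> real j * h n" "real k * h n \<le> real i * h n"
        using i h(1)[of n] by (auto intro!: mult_right_mono)
      have "dist (i * h n, x n i) (k * h n, x n k) \<le> dist (i * h n) (k * h n) + dist (x n i) (x n k)"
        unfolding dist_Pair_Pair by (rule sqrt_sum_squares_le_sum) auto
      also have "\<dots> \<le> (real i * h n - real k * h n) + c * (real i * h n - real k * h n)"
        using chain_lip[of k i n] i kj \<open>real k * h n \<le> real i * h n\<close>
        by (intro add_mono) (auto simp: dist_norm)
      also have "\<dots> = (1 + c) * (real i * h n - real k * h n)"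
        by (simp add: algebra_simps)
      also have "\<dots> < (1 + c) * \<delta>"
        using short \<open>real i * h n \<le> real j * h n\<close> \<open>0 < c\<close> by (intro mult_strict_left_mono) auto
      also have "\<dots> = d"
        using \<open>0 < c\<close> by (simp add: \<delta>_def)
      finally show "norm (f (i * h n) (x n i) - f (k * h n) (x n k)) \<le> e"
        using d[of "k * h n" "x n k" "i * h n" "x n i"] chain_time x_mem i kj
        by (auto simp: dist_norm intro: less_imp_le)
    qed (use kj h(1)[of n] in auto)
    have "norm (u t - u s - (t - s) *\<^sub>R f s (u s)) \<le> e * (t - s)"
      if st: "s \<in> {0..\<beta>}" "t \<in> {0..\<beta>}" "s \<le> t" "t - s < \<delta>" for s t
    proof (rule tendsto_le[OF G(2)])
      let ?len = "\<lambda>n. real (cell n t) * h n - real (cell n s) * h n"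
      have len: "(?len \<longlongrightarrow> t - s) G"
        by (intro tendsto_intros time_lim st)
      show "((\<lambda>n. norm (x n (cell n t) - x n (cell n s) - ?len n *\<^sub>R f (cell n s * h n) (x n (cell n s))))
          \<longlongrightarrow> norm (u t - u s - (t - s) *\<^sub>R f s (u s))) G"
        by (intro tendsto_intros u_lim len F_lim st)
      have "((\<lambda>n. (1 / Suc n + e) * ?len n) \<longlongrightarrow> (0 + e) * (t - s)) G"
        by (intro tendsto_mult tendsto_add G_inv len tendsto_const)
      then show "((\<lambda>n. (1 / Suc n + e) * ?len n) \<longlongrightarrow> e * (t - s)) G"
        by simp
      show "\<forall>\<^sub>F n in G. norm (x n (cell n t) - x n (cell n s) - ?len n *\<^sub>R f (cell n s * h n) (x n (cell n s)))
          \<le> (1 / Suc n + e) * ?len n"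
        using order_tendstoD(2)[OF len st(4)]
        by eventually_elim (intro chain cell_mono st cell_le)
    qed
    then show ?thesis
      using \<open>0 < \<delta>\<close> by blast
  qed
  have "cell n 0 = 0" for n
    using \<beta>(1) by (simp add: cell_def)
  then have "((\<lambda>n. x0) \<longlongrightarrow> u 0) G"
    using u_lim[of 0] by (simp add: x_0)
  then have "u 0 = x0"
    using tendsto_unique[OF G(2)] tendsto_const by blast
  moreover have "(u has_vector_derivative f t (u t)) (at t)" if "t \<in> {0<..<\<beta>}" for t
    using has_vector_derivative_of_increments[OF cont_F increments that] .
  ultimately show thesis
    using that[of u] cont_u u_mem unfolding D_def by blast
qed

section \<open>Comparison with functions of class \<open>U\<^sub>1\<close>\<close>

lemma has_real_derivative_imp_left_quotient:
  assumes "(g has_real_derivative g') (at t)"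
  shows "((\<lambda>h. (g t - g (t - h)) / h) \<longlongrightarrow> g') (at_right 0)"
proof -
  have "((\<lambda>h. (g (t + h) - g t) / h) \<longlongrightarrow> g') (at_left 0)"
    using assms by (auto simp: DERIV_def intro: filterlim_mono at_le)
  then have "((\<lambda>h. (g (t + - h) - g t) / - h) \<longlongrightarrow> g') (at_right 0)"
    unfolding filterlim_at_left_to_right by simp
  moreover have "(\<lambda>h. (g (t + - h) - g t) / - h) = (\<lambda>h. (g t - g (t - h)) / h)"
    by (simp add: fun_eq_iff minus_divide_left)
  ultimately show ?thesis
    by simp
qed

lemma dini_lower_left_le_derivative:
  assumes deriv: "(g has_real_derivative g') (at t)"
    and le: "\<forall>\<^sub>F h in at_right 0. m t - m (t - h) \<le> g t - g (t - h)"
  shows "dini_lower_left m t \<le> ereal g'"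
proof -
  have "dini_lower_left m t \<le> Liminf (at_right 0) (\<lambda>h. ereal ((g t - g (t - h)) / h))"
    unfolding dini_lower_left_def
    by (intro Liminf_mono eventually_mono[OF eventually_conj[OF le eventually_at_right_less]])
      (auto intro: divide_right_mono)
  also have "\<dots> = ereal g'"
    by (intro lim_imp_Liminf trivial_limit_at_right_real tendsto_ereal
        has_real_derivative_imp_left_quotient deriv)
  finally show ?thesis .
qed

lemma dini_lower_left_mono:
  assumes "\<forall>\<^sub>F h in at_right 0. \<rho> t - \<rho> (t - h) \<le> m t - m (t - h)"
  shows "dini_lower_left \<rho> t \<le> dini_lower_left m t"
  unfolding dini_lower_left_def
  by (intro Liminf_mono eventually_mono[OF eventually_conj[OF assms eventually_at_right_less]])
    (auto intro: divide_right_mono)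

text \<open>Evaluation at a point where the norm of the difference is attained is a minorant of that norm
  which touches it at time \<open>t\<close>; a touching minorant has the steeper difference quotients to the left.\<close>

lemma dini_lower_left_norm_diff_le:
  fixes \<sigma> \<tau> :: "real \<Rightarrow> 'p::topological_space \<Rightarrow>\<^sub>C real"
  assumes \<sigma>: "(\<sigma> has_vector_derivative v) (at t)" and \<tau>: "(\<tau> has_vector_derivative w) (at t)"
    and p: "norm (\<sigma> t - \<tau> t) \<le> \<sigma> t p - \<tau> t p"
  shows "dini_lower_left (\<lambda>s. norm (\<sigma> s - \<tau> s)) t \<le> ereal (v p - w p)"
proof (rule dini_lower_left_le_derivative)
  have "bounded_linear (\<lambda>g :: 'p \<Rightarrow>\<^sub>C real. g p)"
  proof (rule bounded_linear_intro[of _ 1])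
    show "norm (g p) \<le> norm g * 1" for g :: "'p \<Rightarrow>\<^sub>C real"
      by (simp only: mult_1_right norm_bounded)
  qed simp_all
  from bounded_linear.has_vector_derivative[OF this has_vector_derivative_diff[OF \<sigma> \<tau>]]
  show "((\<lambda>s. \<sigma> s p - \<tau> s p) has_real_derivative v p - w p) (at t)"
    by (simp add: has_real_derivative_iff_has_vector_derivative)
  have "\<sigma> s p - \<tau> s p \<le> norm (\<sigma> s - \<tau> s)" for s
    using norm_bounded[of "\<sigma> s - \<tau> s" p] by simp
  then have "norm (\<sigma> t - \<tau> t) - norm (\<sigma> (t - h) - \<tau> (t - h))
      \<le> (\<sigma> t p - \<tau> t p) - (\<sigma> (t - h) p - \<tau> (t - h) p)" for h
    using p by (intro diff_mono)
  then show "\<forall>\<^sub>F h in at_right 0. norm (\<sigma> t - \<tau> t) - norm (\<sigma> (t - h) - \<tau> (t - h))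
      \<le> (\<sigma> t p - \<tau> t p) - (\<sigma> (t - h) p - \<tau> (t - h) p)"
    by (rule always_eventually[OF allI])
qed

text \<open>Before the first crossing \<open>m\<close> lies below \<open>\<rho>\<close>, so it must rise at least as fast as \<open>\<rho>\<close> in order to
  meet it.\<close>

lemma first_crossing_left_dini:
  fixes m \<rho> :: "real \<Rightarrow> real"
  assumes m: "continuous_on {a..b} m" and \<rho>: "continuous_on {a..b} \<rho>"
    and "m a < \<rho> a" "s \<in> {a..b}" "\<rho> s \<le> m s"
  obtains t where "t \<in> {a<..s}" "m t = \<rho> t" "dini_lower_left \<rho> t \<le> dini_lower_left m t"
proof -
  define d where "d = (\<lambda>t. \<rho> t - m t)"
  have d: "continuous_on {a..s} d"
    unfolding d_def using assms
    by (intro continuous_intros continuous_on_subset[OF m] continuous_on_subset[OF \<rho>]) auto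
  have "compact ({a..s} \<inter> d -` {..0})"
    using continuous_closed_preimage[OF d] by (simp add: compact_eq_bounded_closed bounded_Int)
  moreover have "s \<in> {a..s} \<inter> d -` {..0}"
    using assms by (simp add: d_def)
  ultimately obtain t where t: "t \<in> {a..s}" "d t \<le> 0" and least: "\<And>z. z \<in> {a..s} \<Longrightarrow> d z \<le> 0 \<Longrightarrow> t \<le> z"
    using compact_attains_inf[of "{a..s} \<inter> d -` {..0}"]
    by (metis (no_types, lifting) IntE IntI empty_iff vimageE vimageI atMost_iff)
  have "0 < d a"
    using \<open>m a < \<rho> a\<close> by (simp add: d_def)
  then have "a < t"
    using t by (cases "a = t") auto
  have "\<exists>z\<ge>a. z \<le> t \<and> d z = 0"
    using t \<open>0 < d a\<close> by (intro IVT2' continuous_on_subset[OF d]) auto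
  then have "d t = 0"
    using least t(1) by (metis atLeastAtMost_iff order_antisym order_trans order_refl)
  have "\<forall>\<^sub>F h in at_right 0. h < t - a"
    using eventually_at_right_real[of 0 "t - a"] \<open>a < t\<close> by (auto elim: eventually_mono)
  then have "\<forall>\<^sub>F h in at_right 0. \<rho> t - \<rho> (t - h) \<le> m t - m (t - h)"
    using eventually_at_right_less[of "0::real"]
  proof eventually_elim
    case (elim h)
    then have "0 \<le> d (t - h)"
      using least[of "t - h"] t(1) by (cases "d (t - h) \<le> 0") auto
    then show ?case
      using \<open>d t = 0\<close> by (simp add: d_def)
  qed
  then show thesis
    using that[of t] \<open>a < t\<close> t(1) \<open>d t = 0\<close> dini_lower_left_mono by (simp add: d_def)
qed

text \<open>The condition \<open>\<rho>\<^sub>i (t\<^sub>i) \<ge> \<delta> t\<^sub>i\<close> of the class \<open>U\<^sub>1\<close> is what a function of order \<open>o(t)\<close> needs in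
  order to start below \<open>\<rho>\<^sub>i\<close>. If \<open>m\<close> were positive at \<open>t0\<close>, then functions \<open>\<rho>\<^sub>i \<le> m t0 / 2\<close> would
  be crossed before \<open>t0\<close>.\<close>

lemma class_U1_comparison:
  assumes U1: "class_U1 T \<omega>" and "\<beta> \<le> T" and m: "continuous_on {0..\<beta>} m"
    and small: "((\<lambda>t. m t / t) \<longlongrightarrow> 0) (at_right 0)"
    and dini: "\<And>t. t \<in> {0<..<\<beta>} \<Longrightarrow> 0 < m t \<Longrightarrow> dini_lower_left m t \<le> ereal (\<omega> t (m t))"
    and t0: "t0 \<in> {0<..<\<beta>}"
  shows "m t0 \<le> 0"
proof (rule ccontr)
  assume "\<not> m t0 \<le> 0"
  then have "0 < m t0 / 2"
    by simp
  then obtain \<delta> s \<rho> \<eta> where "0 < \<delta>" and s: "\<And>i::nat. s i \<in> {0<..<T}" "s \<longlonglongrightarrow> 0"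
    and \<rho>: "\<And>i. continuous_on {s i..T} (\<rho> i)" "\<And>i. \<rho> i (s i) \<ge> \<delta> * s i"
      "\<And>i t. t \<in> {s i<..T} \<Longrightarrow> 0 < \<rho> i t \<and> \<rho> i t \<le> m t0 / 2"
    and \<eta>: "\<And>i. 0 < \<eta> i"
      "\<And>i t. t \<in> {s i<..T} \<Longrightarrow> dini_lower_left (\<rho> i) t \<ge> ereal (\<omega> t (\<rho> i t) + \<eta> i)"
    using U1 unfolding class_U1_def by metis
  have s_lim: "filterlim s (at_right 0) sequentially"
    using s by (auto simp: filterlim_at less_imp_neq[symmetric] intro!: always_eventually)
  have "\<forall>\<^sub>F t in at_right 0. m t / t < \<delta> \<and> t < t0"
    using order_tendstoD(2)[OF small \<open>0 < \<delta>\<close>] eventually_at_right_real[of 0 t0] t0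
    by (auto elim: eventually_elim2)
  from eventually_compose_filterlim[OF this s_lim]
  have "\<forall>\<^sub>F i in sequentially. m (s i) / s i < \<delta> \<and> s i < t0" .
  then obtain i where i: "m (s i) / s i < \<delta>" "s i < t0"
    by (auto dest: eventually_happens)
  have "0 < s i"
    using s(1)[of i] by simp
  have "m (s i) < \<rho> i (s i)"
    using i(1) \<open>0 < s i\<close> \<rho>(2)[of i] by (simp add: field_simps)
  moreover have "\<rho> i t0 \<le> m t0"
    using \<rho>(3)[of t0 i] i(2) t0 \<open>\<beta> \<le> T\<close> \<open>0 < m t0 / 2\<close> by auto
  ultimately obtain t where t: "t \<in> {s i<..t0}" "m t = \<rho> i t"
    "dini_lower_left (\<rho> i) t \<le> dini_lower_left m t"
    using first_crossing_left_dini[of "s i" \<beta> m "\<rho> i" t0] i(2) t0 \<open>0 < s i\<close> \<open>\<beta> \<le> T\<close>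
      continuous_on_subset[OF m, of "{s i..\<beta>}"] continuous_on_subset[OF \<rho>(1)[of i], of "{s i..\<beta>}"]
    by auto
  have t_mem: "t \<in> {s i<..T}" "t \<in> {0<..<\<beta>}"
    using t(1) t0 \<open>0 < s i\<close> \<open>\<beta> \<le> T\<close> by auto
  have "ereal (\<omega> t (\<rho> i t) + \<eta> i) \<le> dini_lower_left (\<rho> i) t"
    by (rule \<eta>(2)[OF t_mem(1)])
  also have "\<dots> \<le> dini_lower_left m t"
    by (rule t(3))
  also have "\<dots> \<le> ereal (\<omega> t (\<rho> i t))"
    using dini[OF t_mem(2)] \<rho>(3)[OF t_mem(1)] t(2) by simp
  finally show False
    using \<eta>(1)[of i] by simp
qed

text \<open>The mean value inequality on \<open>[0, t]\<close>, where the velocities differ arbitrarily little as \<open>t \<rightarrow> 0\<close>.\<close>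

lemma norm_diff_over_time_tendsto_0:
  fixes \<sigma> \<tau> :: "real \<Rightarrow> 'b::real_normed_vector"
  assumes "0 < \<beta>" and cont: "continuous_on {0..\<beta>} \<sigma>" "continuous_on {0..\<beta>} \<tau>" and "\<sigma> 0 = \<tau> 0"
    and deriv: "\<And>t. t \<in> {0<..<\<beta>} \<Longrightarrow> (\<sigma> has_vector_derivative v t) (at t)"
      "\<And>t. t \<in> {0<..<\<beta>} \<Longrightarrow> (\<tau> has_vector_derivative w t) (at t)"
    and lim: "((\<lambda>t. v t - w t) \<longlongrightarrow> 0) (at_right 0)"
  shows "((\<lambda>t. norm (\<sigma> t - \<tau> t) / t) \<longlongrightarrow> 0) (at_right 0)"
proof (rule tendstoI)
  fix e :: real assume "0 < e"
  then have "\<forall>\<^sub>F t in at_right 0. norm (v t - w t) < e / 2"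
    using tendstoD[OF lim, of "e / 2"] by simp
  then obtain b where b: "0 < b" "\<And>t. 0 < t \<Longrightarrow> t < b \<Longrightarrow> norm (v t - w t) < e / 2"
    by (auto simp: eventually_at_right[OF zero_less_one])
  have le: "norm (\<sigma> t - \<tau> t) \<le> e / 2 * t" if t: "t \<in> {0<..<min b \<beta>}" for t
  proof -
    have "norm ((\<sigma> t - \<tau> t) - (\<sigma> 0 - \<tau> 0)) \<le> e / 2 * t - e / 2 * 0"
    proof (rule differentiable_bound_general)
      show "continuous_on {0..t} (\<lambda>s. \<sigma> s - \<tau> s)"
        using t by (intro continuous_intros continuous_on_subset[OF cont(1)] continuous_on_subset[OF cont(2)]) auto
      fix s assume s: "0 < s" "s < t"
      show "((\<lambda>s. \<sigma> s - \<tau> s) has_vector_derivative (v s - w s)) (at s)"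
        using s t by (intro has_vector_derivative_diff deriv) auto
      show "((\<lambda>s. e / 2 * s) has_vector_derivative e / 2) (at s)"
        unfolding has_real_derivative_iff_has_vector_derivative[symmetric]
        by (auto intro!: derivative_eq_intros)
      show "norm (v s - w s) \<le> e / 2"
        using b(2)[of s] s t by auto
    qed (use t in \<open>auto intro!: continuous_intros\<close>)
    then show ?thesis
      using \<open>\<sigma> 0 = \<tau> 0\<close> by simp
  qed
  have "\<forall>\<^sub>F t in at_right 0. t \<in> {0<..<min b \<beta>}"
    using b(1) \<open>0 < \<beta>\<close> by (intro eventually_at_right_real) simp
  then show "\<forall>\<^sub>F t in at_right 0. dist (norm (\<sigma> t - \<tau> t) / t) 0 < e"
  proof eventually_elim
    case (elim t)
    then have "e / 2 * t < e * t"
      using \<open>0 < e\<close> by simp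
    then show ?case
      using le[OF elim] elim by (simp add: field_simps)
  qed
qed

lemma dini_lower_left_le_of_nearest_points:
  fixes A B :: "'a::euclidean_space set"
  assumes A: "A \<in> convex_bodies" "\<sigma> t = support_fun A"
    and B: "B \<in> convex_bodies" "\<tau> t = support_fun B"
    and \<sigma>: "(\<sigma> has_vector_derivative v) (at t)" and \<tau>: "(\<tau> has_vector_derivative w) (at t)"
    and ab: "a \<in> A" "b \<in> B" "a \<noteq> b" "norm (a - b) = excess {a} B" "norm (a - b) = hausdorff_dist A B"
    and le: "v (Abs_usphere ((a - b) /\<^sub>R norm (a - b))) - w (Abs_usphere ((a - b) /\<^sub>R norm (a - b))) \<le> K"
  shows "dini_lower_left (\<lambda>s. norm (\<sigma> s - \<tau> s)) t \<le> ereal K"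
proof -
  let ?p = "Abs_usphere ((a - b) /\<^sub>R norm (a - b))"
  have "norm (\<sigma> t - \<tau> t) = norm (a - b)"
    using hausdorff_dist_eq_norm[OF A(1) B(1)] ab(5) A(2) B(2) by simp
  also have "\<dots> \<le> \<sigma> t ?p - \<tau> t ?p"
    unfolding A(2) B(2)
    by (rule support_fun_diff_nearest_point[OF A(1) B(1) ab(1-3)]) (simp add: ab(4) excess_singleton_le)
  finally have "dini_lower_left (\<lambda>s. norm (\<sigma> s - \<tau> s)) t \<le> ereal (v ?p - w ?p)"
    by (rule dini_lower_left_norm_diff_le[OF \<sigma> \<tau>])
  also have "\<dots> \<le> ereal K"
    using le by simp
  finally show ?thesis .
qed

section \<open>Existence and uniqueness for the set evolution\<close>

theorem theorem18:
  fixes f :: "real \<Rightarrow> ('a::euclidean_space usphere \<Rightarrow>\<^sub>C real) \<Rightarrow> ('a usphere \<Rightarrow>\<^sub>C real)"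
    and A0 :: "'a set"
    and T r c \<beta> :: real
    and \<omega> :: "real \<Rightarrow> real \<Rightarrow> real"
    and D :: "('a usphere \<Rightarrow>\<^sub>C real) set"
    and D' :: "'a set set"
  assumes "T > 0"
    and "\<And>t \<sigma>. t \<in> {0..T} \<Longrightarrow> \<sigma> \<in> support_funs \<Longrightarrow> f t \<sigma> \<in> support_fun_diffs"
    and "continuous_on ({0..T} \<times> support_funs) (\<lambda>(t, \<sigma>). f t \<sigma>)"
    and "A0 \<in> convex_bodies"
    and "r > 0"
    and "D = {\<sigma> \<in> support_funs. norm (\<sigma> - support_fun A0) \<le> r}"
    and "D' = {A \<in> convex_bodies. hausdorff_dist A A0 \<le> r}"
    and "c > 0"
    and "\<And>t \<sigma>. t \<in> {0..T} \<Longrightarrow> \<sigma> \<in> D \<Longrightarrow> norm (f t \<sigma>) \<le> c"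
    and "\<beta> = min T (r / c)"
    and "class_U1 T \<omega>"
    and "\<And>t \<sigma>. t \<in> {0..T} \<Longrightarrow> \<sigma> \<in> support_funs \<Longrightarrow>
      f t \<sigma> \<in> closure {\<tau> - \<mu> *\<^sub>R \<sigma> | \<tau> \<mu>. \<tau> \<in> support_funs \<and> \<mu> \<ge> 0}"
    and "\<And>t A B. t \<in> {0<..\<beta>} \<Longrightarrow> A \<in> D' \<Longrightarrow> B \<in> D' \<Longrightarrow> A \<noteq> B \<Longrightarrow>
      \<exists>a\<in>A. \<exists>b\<in>B. a \<noteq> b \<and>
        (let p = (a - b) /\<^sub>R norm (a - b) in
          (norm (a - b) = excess {a} B \<and> excess {a} B = excess A B \<and>
           excess A B = hausdorff_dist A B \<and>
           f t (support_fun A) (Abs_usphere p) - f t (support_fun B) (Abs_usphere p)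
             \<le> \<omega> t (hausdorff_dist A B)) \<or>
          (norm (a - b) = excess {b} A \<and> excess {b} A = excess B A \<and>
           excess B A = hausdorff_dist A B \<and>
           f t (support_fun B) (Abs_usphere (- p)) - f t (support_fun A) (Abs_usphere (- p))
             \<le> \<omega> t (hausdorff_dist A B)))"
  shows "\<exists>!\<sigma>. \<sigma> \<in> {0..\<beta>} \<rightarrow>\<^sub>E D \<and> is_solution f \<beta> (support_fun A0) \<sigma>"
proof -
  let ?\<sigma>0 = "support_fun A0"
  have D_eq: "D = support_funs \<inter> cball ?\<sigma>0 r"
    using assms(6) by (auto simp: dist_norm norm_minus_commute)
  have \<beta>: "0 < \<beta>" "\<beta> \<le> T"
    using assms(1,5,8,10) by auto
  have "\<exists>u. u \<in> {0..\<beta>} \<rightarrow>\<^sub>E D \<and> is_solution f \<beta> ?\<sigma>0 u"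
  proof -
    have tangent: "f t x \<in> closure {\<mu> *\<^sub>R (y - x) | y \<mu>. y \<in> support_funs \<and> 0 \<le> \<mu>}"
      if "t \<in> {0..T}" "x \<in> support_funs \<inter> cball ?\<sigma>0 r" for t x
    proof (rule subsetD[OF closure_mono assms(12)])
      show "{\<tau> - \<mu> *\<^sub>R x | \<tau> \<mu>. \<tau> \<in> support_funs \<and> \<mu> \<ge> 0}
          \<subseteq> {\<mu> *\<^sub>R (y - x) | y \<mu>. y \<in> support_funs \<and> 0 \<le> \<mu>}"
      proof clarify
        fix \<tau> :: "'a usphere \<Rightarrow>\<^sub>C real" and \<mu> :: real
        assume "\<tau> \<in> support_funs" "0 \<le> \<mu>"
        \<comment> \<open>The shift \<open>1 + \<mu>\<close> avoids a division by zero when \<open>\<mu> = 0\<close>.\<close>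
        let ?y = "(1 / (1 + \<mu>)) *\<^sub>R (\<tau> + x)"
        have "?y \<in> support_funs"
          using \<open>\<tau> \<in> support_funs\<close> \<open>0 \<le> \<mu>\<close> that
          by (intro support_funs_scaleR support_funs_add) auto
        moreover have "\<tau> - \<mu> *\<^sub>R x = (1 + \<mu>) *\<^sub>R (?y - x)"
          using \<open>0 \<le> \<mu>\<close> by (simp add: scaleR_diff_right) (simp add: algebra_simps)
        ultimately show "\<exists>y \<nu>. \<tau> - \<mu> *\<^sub>R x = \<nu> *\<^sub>R (y - x) \<and> y \<in> support_funs \<and> 0 \<le> \<nu>"
          using \<open>0 \<le> \<mu>\<close> by (intro exI[of _ ?y] exI[of _ "1 + \<mu>"]) simp
      qed
    qed (use that in auto)
    have cont: "continuous_on ({0..T} \<times> (support_funs \<inter> cball ?\<sigma>0 r)) (\<lambda>(t, \<sigma>). f t \<sigma>)"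
      by (rule continuous_on_subset[OF assms(3)]) auto
    have "?\<sigma>0 \<in> support_funs"
      using assms(4) by (auto simp: support_funs_def)
    then obtain u where u: "continuous_on {0..\<beta>} u" "u ` {0..\<beta>} \<subseteq> D" "u 0 = ?\<sigma>0"
      "\<And>t. t \<in> {0<..<\<beta>} \<Longrightarrow> (u has_vector_derivative f t (u t)) (at t)"
      using convex_viability[OF convex_support_funs compact_support_funs_cball _
          assms(1,5,8) cont tangent assms(9)[unfolded D_eq]]
      unfolding assms(10) D_eq by metis
    let ?u = "restrict u {0..\<beta>}"
    have "(?u has_vector_derivative f t (?u t)) (at t)" if "t \<in> {0<..<\<beta>}" for t
      using has_vector_derivative_transform_within_open[OF u(4)[OF that] open_greaterThanLessThan that, of ?u] that
      by simp
    moreover have "continuous_on {0..\<beta>} ?u"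
      using u(1) by (rule continuous_on_eq) simp
    moreover have "?u ` {0..\<beta>} \<subseteq> support_funs"
      using u(2) by (auto simp: D_eq)
    moreover have "?u 0 = ?\<sigma>0"
      using u(3) \<beta>(1) by simp
    ultimately have "is_solution f \<beta> ?\<sigma>0 ?u"
      by (simp add: is_solution_def)
    moreover have "?u \<in> {0..\<beta>} \<rightarrow>\<^sub>E D"
      using u(2) by auto
    ultimately show ?thesis
      by blast
  qed
  moreover have "\<sigma> = \<tau>"
    if \<sigma>_mem: "\<sigma> \<in> {0..\<beta>} \<rightarrow>\<^sub>E D" and \<sigma>_sol: "is_solution f \<beta> ?\<sigma>0 \<sigma>"
      and \<tau>_mem: "\<tau> \<in> {0..\<beta>} \<rightarrow>\<^sub>E D" and \<tau>_sol: "is_solution f \<beta> ?\<sigma>0 \<tau>" for \<sigma> \<tau>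
  proof -
    define m where "m = (\<lambda>t. norm (\<sigma> t - \<tau> t))"
    have \<sigma>: "continuous_on {0..\<beta>} \<sigma>" "\<sigma> 0 = ?\<sigma>0"
      "\<And>t. t \<in> {0<..<\<beta>} \<Longrightarrow> (\<sigma> has_vector_derivative f t (\<sigma> t)) (at t)"
      using \<sigma>_sol by (auto simp: is_solution_def)
    have \<tau>: "continuous_on {0..\<beta>} \<tau>" "\<tau> 0 = ?\<sigma>0"
      "\<And>t. t \<in> {0<..<\<beta>} \<Longrightarrow> (\<tau> has_vector_derivative f t (\<tau> t)) (at t)"
      using \<tau>_sol by (auto simp: is_solution_def)
    have m: "continuous_on {0..\<beta>} m"
      unfolding m_def by (intro continuous_intros \<sigma> \<tau>)
    have f_lim: "((\<lambda>t. f t (\<rho> t)) \<longlongrightarrow> f 0 ?\<sigma>0) (at_right 0)"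
      if "continuous_on {0..\<beta>} \<rho>" "\<rho> 0 = ?\<sigma>0" "\<rho> \<in> {0..\<beta>} \<rightarrow>\<^sub>E D" for \<rho>
    proof -
      have "(\<lambda>t. (t, \<rho> t)) ` {0..\<beta>} \<subseteq> {0..T} \<times> support_funs"
        using that(3) \<beta>(2) by (auto simp: D_eq PiE_iff)
      then have "continuous_on {0..\<beta>} (\<lambda>t. f t (\<rho> t))"
        using continuous_on_compose2[OF assms(3) continuous_on_Pair[OF continuous_on_id that(1)]]
        by simp
      then have "((\<lambda>t. f t (\<rho> t)) \<longlongrightarrow> f 0 (\<rho> 0)) (at 0 within {0..\<beta>})"
        using \<beta>(1) by (simp add: continuous_on_def)
      then show ?thesis
        using \<beta>(1) that(2) by (simp add: at_within_Icc_at_right)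
    qed
    have small: "((\<lambda>t. m t / t) \<longlongrightarrow> 0) (at_right 0)"
      unfolding m_def
      using norm_diff_over_time_tendsto_0[OF \<beta>(1) \<sigma>(1) \<tau>(1) _ \<sigma>(3) \<tau>(3)] \<sigma>(2) \<tau>(2)
        tendsto_diff[OF f_lim[OF \<sigma>(1,2) \<sigma>_mem] f_lim[OF \<tau>(1,2) \<tau>_mem]] by simp
    have dini: "dini_lower_left m t \<le> ereal (\<omega> t (m t))" if t: "t \<in> {0<..<\<beta>}" and "0 < m t" for t
    proof -
      have "\<sigma> t \<in> D" "\<tau> t \<in> D"
        using t \<sigma>_mem \<tau>_mem by (auto simp: PiE_iff)
      then obtain A B where A: "A \<in> convex_bodies" "\<sigma> t = support_fun A"
        and B: "B \<in> convex_bodies" "\<tau> t = support_fun B"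
        by (auto simp: D_eq support_funs_def)
      have "A \<in> D'" "B \<in> D'"
        using A B \<open>\<sigma> t \<in> D\<close> \<open>\<tau> t \<in> D\<close> hausdorff_dist_eq_norm[OF _ assms(4)] assms(6,7) by auto
      moreover have m_eq: "hausdorff_dist A B = m t"
        using hausdorff_dist_eq_norm[OF A(1) B(1)] A(2) B(2) by (simp add: m_def)
      moreover have "A \<noteq> B"
        using A(2) B(2) \<open>0 < m t\<close> by (auto simp: m_def)
      ultimately obtain a b where ab: "a \<in> A" "b \<in> B" "a \<noteq> b"
        and alternatives: "(norm (a - b) = excess {a} B \<and> norm (a - b) = hausdorff_dist A B \<and>
            f t (\<sigma> t) (Abs_usphere ((a - b) /\<^sub>R norm (a - b)))
              - f t (\<tau> t) (Abs_usphere ((a - b) /\<^sub>R norm (a - b))) \<le> \<omega> t (m t)) \<or>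
          (norm (a - b) = excess {b} A \<and> norm (a - b) = hausdorff_dist A B \<and>
            f t (\<tau> t) (Abs_usphere (- ((a - b) /\<^sub>R norm (a - b))))
              - f t (\<sigma> t) (Abs_usphere (- ((a - b) /\<^sub>R norm (a - b)))) \<le> \<omega> t (m t))"
        using assms(13)[of t A B] t unfolding Let_def A(2) B(2) by force
      \<comment> \<open>The second alternative is the first one with the two solutions exchanged, which reverses the
          direction.\<close>
      from alternatives show ?thesis
      proof (elim disjE conjE)
        assume "norm (a - b) = excess {a} B" "norm (a - b) = hausdorff_dist A B"
          "f t (\<sigma> t) (Abs_usphere ((a - b) /\<^sub>R norm (a - b)))
              - f t (\<tau> t) (Abs_usphere ((a - b) /\<^sub>R norm (a - b))) \<le> \<omega> t (m t)"
        then show ?thesis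
          unfolding m_def by (intro dini_lower_left_le_of_nearest_points[OF A B \<sigma>(3)[OF t] \<tau>(3)[OF t] ab])
      next
        assume nearest: "norm (a - b) = excess {b} A" "norm (a - b) = hausdorff_dist A B"
          and le: "f t (\<tau> t) (Abs_usphere (- ((a - b) /\<^sub>R norm (a - b))))
              - f t (\<sigma> t) (Abs_usphere (- ((a - b) /\<^sub>R norm (a - b)))) \<le> \<omega> t (m t)"
        have "- ((a - b) /\<^sub>R norm (a - b)) = (b - a) /\<^sub>R norm (b - a)"
          by (simp add: norm_minus_commute scaleR_minus_right[symmetric])
        moreover have "hausdorff_dist A B = hausdorff_dist B A"
          by (simp add: hausdorff_dist_def max.commute)
        ultimately have "dini_lower_left (\<lambda>s. norm (\<tau> s - \<sigma> s)) t \<le> ereal (\<omega> t (m t))"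
          using nearest le ab
          by (intro dini_lower_left_le_of_nearest_points[OF B A \<tau>(3)[OF t] \<sigma>(3)[OF t], of b a])
            (auto simp: norm_minus_commute)
        then show ?thesis
          by (simp add: m_def norm_minus_commute)
      qed
    qed
    have "m t \<le> 0" if "t \<in> {0<..<\<beta>}" for t
      by (rule class_U1_comparison[OF assms(11) \<beta>(2) m small dini that])
    then have zero: "m t = 0" if "t \<in> {0<..<\<beta>}" for t
      using that norm_ge_zero[of "\<sigma> t - \<tau> t"] by (simp add: m_def)
    \<comment> \<open>The differential equation is only assumed in the open interval, hence the passage to the closure.\<close>
    have "m t = 0" if "t \<in> {0..\<beta>}" for t
    proof (rule continuous_constant_on_closure[where f = m and S = "{0<..<\<beta>}" and x = t and a = 0])
      show "continuous_on (closure {0<..<\<beta>}) m" "t \<in> closure {0<..<\<beta>}"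
        using m \<beta>(1) that by simp_all
    qed (rule zero)
    then show "\<sigma> = \<tau>"
      by (intro PiE_ext[OF \<sigma>_mem \<tau>_mem]) (simp add: m_def)
  qed
  ultimately show ?thesis
    by blast
qed

end
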